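(* Let $k,l,m$ be integers with $k\geq l\geq m\geq 1$ and $l\geq 2$. Then the number of invariant Einstein metrics, up to a homothety, on the space $G/H=SO(k+l+m)/SO(k)\times SO(l)\times SO(m)$ is $4$ if $m>\sqrt{2k+2l-4}$, and is $2$ if $m<\sqrt{k+l}$.
   Context: Let $n=k+l+m$, $\mathfrak g=so(n)$, $\mathfrak h=so(k)\oplus so(l)\oplus so(m)$ (block-diagonal), let $B$ be the Killing form of $\mathfrak g$, $\langle\cdot,\cdot\rangle=-B$, and let $\mathfrak p$ be the $\langle\cdot,\cdot\rangle$-orthogonal complement of $\mathfrak h$ in $\mathfrak g$. Then $\mathfrak p=\mathfrak p_1\oplus\mathfrak p_2\oplus\mathfrak p_3$ orthogonally, where $\mathfrak p_1,\mathfrak p_2,\mathfrak p_3$ are the off-diagonal block subspaces of dimensions $lm$, $km$, $kl$ (coupling the blocks $l,m$; $k,m$; $k,l$ respectively), and $[\mathfrak p_i,\mathfrak p_i]\subset\mathfrak h$. The invariant metrics considered are the three-parameter family determined by the $\mathrm{Ad}(H)$-invariant inner products $x_1\langle\cdot,\cdot\rangle|_{\mathfrak p_1}+x_2\langle\cdot,\cdot\rangle|_{\mathfrak p_2}+x_3\langle\cdot,\cdot\rangle|_{\mathfrak p_3}$ with $x_1,x_2,x_3>0$. Put $a_1=\frac{k}{2(n-2)}$, $a_2=\frac{l}{2(n-2)}$, $a_3=\frac{m}{2(n-2)}$. The Ricci tensor of such a metric $(\cdot,\cdot)$ equals $\sum_i r_i\,(\cdot,\cdot)|_{\mathfrak p_i}$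 with $$r_i=\frac{1}{2x_i}+\frac{a_i}{2}\left(\frac{x_i}{x_jx_k}-\frac{x_k}{x_ix_j}-\frac{x_j}{x_ix_k}\right),\qquad \{i,j,k\}=\{1,2,3\}$$ (in this formula $k$ is an index), so the metric is Einstein if and only if $r_1=r_2=r_3$. "Up to a homothety" means that $(x_1,x_2,x_3)$ and $(cx_1,cx_2,cx_3)$, $c>0$, are identified (and no further identification is made). *)

theory Defs
  imports "HOL-Analysis.Analysis"
begin

text \<open>
  Square matrices are elements of the type \<open>real^'n^'n\<close>.  Note that \<open>*\<close> on this type is
  componentwise; the matrix product is \<open>**\<close>.
\<close>

definition lie_bracket :: "real^'n^'n \<Rightarrow> real^'n^'n \<Rightarrow> real^'n^'n" where
  "lie_bracket X Y = X ** Y - Y ** X"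

definition so :: "(real^'n^'n) set" where
  "so = {A. transpose A = - A}"

text \<open>
  The trace of a linear endomorphism \<open>f\<close> of a subspace \<open>V\<close>: the sum of the diagonal coefficients
  of \<open>f\<close> in a basis of \<open>V\<close> (independent of the basis if \<open>f\<close> is linear on \<open>V\<close> and maps \<open>V\<close>
  into itself).
\<close>

definition trace_on :: "'v::real_vector set \<Rightarrow> ('v \<Rightarrow> 'v) \<Rightarrow> real" where
  "trace_on V f =
     (let B = (SOME B. B \<subseteq> V \<and> independent B \<and> V \<subseteq> span B)
      in \<Sum>b\<in>B. representation B (f b) b)"

definition killing_form ::
    "(real^'n^'n) set \<Rightarrow> real^'n^'n \<Rightarrow> real^'n^'n \<Rightarrow> real" where
  "killing_form \<gg> X Y = trace_on \<gg> (\<lambda>Z. lie_bracket X (lie_bracket Y Z))"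

text \<open>The \<open>V\<close>-component of \<open>X\<close> with respect to a direct sum decomposition \<open>V \<oplus> W\<close>.\<close>

definition component :: "'v::ab_group_add set \<Rightarrow> 'v set \<Rightarrow> 'v \<Rightarrow> 'v" where
  "component V W X = (THE v. v \<in> V \<and> X - v \<in> W)"


text \<open>
  Let \<open>\<hh> \<oplus> \<pp>\<close> be a reductive decomposition of the Lie algebra of \<open>G\<close>, where \<open>\<hh>\<close> is the Lie
  algebra of \<open>H\<close>.  A \<open>G\<close>-invariant Riemannian metric on \<open>G/H\<close> is the same as an
  \<open>Ad(H)\<close>-invariant inner product \<open>g\<close> on \<open>\<pp>\<close>, the tangent space at the base point.
  By Nomizu's theorem (Kobayashi and Nomizu, Foundations of Differential Geometry II, Chapter X,
  Proposition 2.3 and Theorem 3.3), the Levi-Civita connection is given by the bilinear map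
  \<open>\<Lambda>\<close> with \<open>\<Lambda>(X)Y = 1/2 [X,Y]\<^sub>\<pp> + U(X,Y)\<close> and
  \<open>2 g(U(X,Y),Z) = g([Z,X]\<^sub>\<pp>,Y) + g(X,[Z,Y]\<^sub>\<pp>)\<close>, and the curvature tensor at the base point by
  \<open>R(X,Y)Z = \<Lambda>(X)\<Lambda>(Y)Z - \<Lambda>(Y)\<Lambda>(X)Z - \<Lambda>([X,Y]\<^sub>\<pp>)Z - [[X,Y]\<^sub>\<hh>,Z]\<close>.
\<close>

definition levi_civita ::
    "(real^'n^'n) set \<Rightarrow> (real^'n^'n) set \<Rightarrow> (real^'n^'n \<Rightarrow> real^'n^'n \<Rightarrow> real)
      \<Rightarrow> real^'n^'n \<Rightarrow> real^'n^'n \<Rightarrow> real^'n^'n" where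
  "levi_civita \<hh> \<pp> g X Y =
     (THE W. W \<in> \<pp> \<and> (\<forall>Z\<in>\<pp>. 2 * g W Z =
          g (component \<pp> \<hh> (lie_bracket X Y)) Z
        + g (component \<pp> \<hh> (lie_bracket Z X)) Y
        + g X (component \<pp> \<hh> (lie_bracket Z Y))))"

definition curvature ::
    "(real^'n^'n) set \<Rightarrow> (real^'n^'n) set \<Rightarrow> (real^'n^'n \<Rightarrow> real^'n^'n \<Rightarrow> real)
      \<Rightarrow> real^'n^'n \<Rightarrow> real^'n^'n \<Rightarrow> real^'n^'n \<Rightarrow> real^'n^'n" where
  "curvature \<hh> \<pp> g X Y Z =
     levi_civita \<hh> \<pp> g X (levi_civita \<hh> \<pp> g Y Z)
   - levi_civita \<hh> \<pp> g Y (levi_civita \<hh> \<pp> g X Z)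
   - levi_civita \<hh> \<pp> g (component \<pp> \<hh> (lie_bracket X Y)) Z
   - lie_bracket (component \<hh> \<pp> (lie_bracket X Y)) Z"

definition ricci ::
    "(real^'n^'n) set \<Rightarrow> (real^'n^'n) set \<Rightarrow> (real^'n^'n \<Rightarrow> real^'n^'n \<Rightarrow> real)
      \<Rightarrow> real^'n^'n \<Rightarrow> real^'n^'n \<Rightarrow> real" where
  "ricci \<hh> \<pp> g Y Z = trace_on \<pp> (\<lambda>X. curvature \<hh> \<pp> g X Y Z)"

definition einstein ::
    "(real^'n^'n) set \<Rightarrow> (real^'n^'n) set \<Rightarrow> (real^'n^'n \<Rightarrow> real^'n^'n \<Rightarrow> real) \<Rightarrow> bool" where
  "einstein \<hh> \<pp> g \<longleftrightarrow> (\<exists>c. \<forall>X\<in>\<pp>. \<forall>Y\<in>\<pp>. ricci \<hh> \<pp> g X Y = c * g X Y)"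


text \<open>
  The index type \<open>'k + ('l + 'm)\<close> has \<open>k + l + m\<close> elements, split into three blocks
  of sizes \<open>k = CARD('k)\<close>, \<open>l = CARD('l)\<close>, \<open>m = CARD('m)\<close>, numbered 1, 2, 3.
\<close>

fun block :: "'k + ('l + 'm) \<Rightarrow> nat" where
  "block (Inl _) = 1"
| "block (Inr (Inl _)) = 2"
| "block (Inr (Inr _)) = 3"

type_synonym ('k, 'l, 'm) block_matrix = "real^('k + ('l + 'm))^('k + ('l + 'm))"

text \<open>The subalgebra \<open>so(k) \<oplus> so(l) \<oplus> so(m)\<close> of \<open>so(k + l + m)\<close>.\<close>

definition isotropy :: "('k::finite, 'l::finite, 'm::finite) block_matrix set" where
  "isotropy = {A \<in> so. \<forall>i j. block i \<noteq> block j \<longrightarrow> A $ i $ j = 0}"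

definition inner_prod ::
    "('k::finite, 'l::finite, 'm::finite) block_matrix \<Rightarrow> ('k, 'l, 'm) block_matrix \<Rightarrow> real" where
  "inner_prod X Y = - killing_form so X Y"

definition isotropy_compl :: "('k::finite, 'l::finite, 'm::finite) block_matrix set" where
  "isotropy_compl = {A \<in> so. \<forall>C\<in>isotropy. inner_prod A C = 0}"

text \<open>
  For \<open>s = 1, 2, 3\<close>, the projection of \<open>\<pp>\<close> onto the off-diagonal block subspace \<open>\<pp>\<^sub>s\<close> coupling
  the two blocks different from \<open>s\<close>.
\<close>

definition part ::
    "nat \<Rightarrow> ('k::finite, 'l::finite, 'm::finite) block_matrix \<Rightarrow> ('k, 'l, 'm) block_matrix" where
  "part s A = (\<chi> i j. if {block i, block j} = {1, 2, 3} - {s} then A $ i $ j else 0)"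

text \<open>
  The inner product \<open>x\<^sub>1\<langle>\<cdot>,\<cdot>\<rangle>|\<pp>\<^sub>1 + x\<^sub>2\<langle>\<cdot>,\<cdot>\<rangle>|\<pp>\<^sub>2 + x\<^sub>3\<langle>\<cdot>,\<cdot>\<rangle>|\<pp>\<^sub>3\<close>; only its values on \<open>\<pp>\<close> are relevant.
\<close>

definition metric ::
    "real \<times> real \<times> real \<Rightarrow> ('k::finite, 'l::finite, 'm::finite) block_matrix
      \<Rightarrow> ('k, 'l, 'm) block_matrix \<Rightarrow> real" where
  "metric = (\<lambda>(x1, x2, x3) X Y.
       x1 * inner_prod (part 1 X) (part 1 Y)
     + x2 * inner_prod (part 2 X) (part 2 Y)
     + x3 * inner_prod (part 3 X) (part 3 Y))"

text \<open>The invariant Einstein metrics on \<open>SO(k+l+m)/SO(k)\<times>SO(l)\<times>SO(m)\<close>, given by their parameters.\<close>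

definition einstein_metrics ::
    "'k::finite itself \<Rightarrow> 'l::finite itself \<Rightarrow> 'm::finite itself \<Rightarrow> (real \<times> real \<times> real) set" where
  "einstein_metrics K L M =
     {(x1, x2, x3). x1 > 0 \<and> x2 > 0 \<and> x3 > 0 \<and>
        einstein (isotropy :: ('k, 'l, 'm) block_matrix set) isotropy_compl (metric (x1, x2, x3))}"

definition homothety :: "((real \<times> real \<times> real) \<times> (real \<times> real \<times> real)) set" where
  "homothety = {(x, y). \<exists>c>0. y = c *\<^sub>R x}"

end

theory Submission
  imports Defs
begin

text \<open>
  Computing the Ricci tensor from its definition turns the Einstein condition into the equality of
  three quadratic forms in \<open>(x, y, z)\<close>.  Normalise \<open>z = 1\<close> and put \<open>v = x + y\<close>, \<open>s = k + l\<close>,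
  \<open>p = s - 2\<close>, \<open>N = 2(k + l + m - 2)\<close>, \<open>d = k - l\<close>.

  If two of the sizes agree, one of the equations splits into two linear factors and the solutions are
  roots of quadratic polynomials.  Otherwise \<open>k > l > m\<close>; the first equation reads
  \<open>(x - y)(sv - N) = d\<close>, and the second one becomes the quartic equation
  \<open>R(v) = (sv - N)\<^sup>2 g(v) - d\<^sup>2 h(v) = 0\<close> with \<open>h - g = 2(v\<^sup>2 - 1)\<close>.  On the branch \<open>sv > N\<close> it has exactly
  one admissible root by Descartes' rule of signs.  On the branch \<open>sv < N\<close>, \<open>R\<close> changes sign between
  the ends of the admissible interval.  If \<open>m\<^sup>2 > 2p\<close>, it also has the opposite signs at the minimum \<open>1 + m/p\<close> of \<open>g\<close>
  and at the point with \<open>y = 1\<close>, which gives three roots there.  If \<open>m\<^sup>2 < s\<close>, the roots satisfy \<open>v > 1\<close> and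
  \<open>N = sv + d sqrt(h(v)/g(v))\<close>, whose right-hand side increases because of \<open>g\<^sup>2 \<ge> 4g - 4\<close>, so that there is only
  one root there.
\<close>

section \<open>Traces and the Killing form of \<open>so(n)\<close>\<close>

text \<open>Components, the Levi-Civita map and traces are given by definite descriptions or by a
  chosen basis, hence they are under control only on the subspaces where they are meaningful. Each
  is replaced by an explicit formula in matrix entries that is linear on all matrices and agrees
  with it there. A trace over skew matrices reads only the (i,j) entry of the image of
  \<open>wedge i j\<close>, so very little of the curvature tensor has to be computed.

  Equal and distinct sizes are separated because x - y = d / (s v - N) recovers a solution from v
  only if d is nonzero. The thresholds are tied to g, whose minimum is (2 p - m^2) / p: it is
  negative exactly when m^2 > 2 (k + l - 2), while m^2 < k + l keeps g positive, so that h / g makes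
  sense everywhere. The degree four of R turns four exhibited roots into an exact count.\<close>

lemma trace_on_eq_sum_Basis:
  fixes V :: "'v::euclidean_space set"
  assumes V: "subspace V"
    and F: "linear F" "\<And>x. x \<in> V \<Longrightarrow> f x = F x" "\<And>x. x \<in> V \<Longrightarrow> F x \<in> V"
    and P: "linear P" "\<And>x. P x \<in> V" "\<And>x. x \<in> V \<Longrightarrow> P x = x"
  shows "trace_on V f = (\<Sum>e\<in>Basis. F (P e) \<bullet> e)"
proof -
  define B where "B = (SOME B. B \<subseteq> V \<and> independent B \<and> V \<subseteq> span B)"
  have "\<exists>B. B \<subseteq> V \<and> independent B \<and> V \<subseteq> span B"
    by (meson basis_exists)
  then have B: "B \<subseteq> V" "independent B" "V \<subseteq> span B"
    unfolding B_def by (metis (mono_tags, lifting) someI_ex)+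
  have fin: "finite B"
    using B(2) independent_imp_finite by blast
  have repr: "(\<Sum>b\<in>B. representation B x b *\<^sub>R b) = x" if "x \<in> V" for x
    using sum_representation_eq[OF B(2) _ fin order_refl] that B(3) by blast
  have lin: "linear (\<lambda>x. representation B (P x) b)" for b
  proof
    show "representation B (P (x + y)) b = representation B (P x) b + representation B (P y) b" for x y
      using B P by (simp add: linear_add[OF P(1)] representation_add subset_iff)
    show "representation B (P (r *\<^sub>R x)) b = r *\<^sub>R representation B (P x) b" for r x
      using B P by (simp add: linear_scale[OF P(1)] representation_scale subset_iff)
  qed
  \<comment> \<open>The trace of F on V is the trace of F composed with P on the whole space, for
    any linear projection P onto V: P e is expanded in B, the sums are exchanged, and the
    coordinates of F b reassemble F b.\<close>
  have "(\<Sum>e\<in>Basis. F (P e) \<bullet> e) = (\<Sum>e\<in>Basis. F (\<Sum>b\<in>B. representation B (P e) b *\<^sub>R b) \<bullet> e)"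
    using repr P(2) by simp
  also have "\<dots> = (\<Sum>e\<in>Basis. \<Sum>b\<in>B. representation B (P e) b * (F b \<bullet> e))"
    by (simp add: linear_sum[OF F(1)] linear_scale[OF F(1)] inner_sum_left)
  also have "\<dots> = (\<Sum>b\<in>B. \<Sum>e\<in>Basis. (F b \<bullet> e) *\<^sub>R representation B (P e) b)"
    by (subst sum.swap) (simp add: mult.commute)
  also have "\<dots> = (\<Sum>b\<in>B. representation B (P (\<Sum>e\<in>Basis. (F b \<bullet> e) *\<^sub>R e)) b)"
    by (simp only: linear_sum[OF lin] linear_scale[OF lin])
  also have "\<dots> = (\<Sum>b\<in>B. representation B (f b) b)"
    using B(1) F P by (intro sum.cong) (auto simp: euclidean_representation)
  finally show ?thesis
    by (simp add: trace_on_def B_def Let_def)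
qed

section \<open>Matrix units and skew matrices with prescribed support\<close>

definition matrix_unit :: "'n::finite \<Rightarrow> 'n \<Rightarrow> real^'n^'n" where
  "matrix_unit i j = (\<chi> a b. if a = i \<and> b = j then 1 else 0)"

lemma sum_Basis_matrix:
  fixes F :: "real^'n^'n \<Rightarrow> real^'n^'n"
  shows "(\<Sum>e\<in>Basis. F e \<bullet> e) = (\<Sum>i\<in>UNIV. \<Sum>j\<in>UNIV. F (matrix_unit i j) $ i $ j)"
proof -
  have unit: "axis i (axis j 1) = matrix_unit i j" for i j :: 'n
    by (auto simp: matrix_unit_def axis_def vec_eq_iff)
  have Basis: "(Basis :: (real^'n^'n) set) = (\<lambda>p. matrix_unit (fst p) (snd p)) ` UNIV"
    by (auto simp: Basis_vec_def image_iff simp flip: unit) blast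
  have inj: "inj (\<lambda>p. matrix_unit (fst p) (snd p) :: real^'n^'n)"
    by (auto simp: inj_def matrix_unit_def vec_eq_iff split: if_splits)
  have inner: "A \<bullet> matrix_unit i j = A $ i $ j" for A :: "real^'n^'n" and i j
    by (simp add: inner_axis flip: unit)
  show ?thesis
    unfolding Basis
    by (simp add: sum.reindex[OF inj] inner sum.cartesian_product case_prod_unfold)
qed

lemma mem_so: "A \<in> so \<longleftrightarrow> (\<forall>i j. A $ j $ i = - A $ i $ j)"
  by (simp add: so_def vec_eq_iff transpose_def)

lemma so_nth: "A \<in> so \<Longrightarrow> A $ j $ i = - A $ i $ j"
  unfolding mem_so by blast

lemma subspace_so: "subspace so"
proof (rule subspaceI)
  show "X + Y \<in> so" if "X \<in> so" "Y \<in> so" for X Y :: "real^'n^'n"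
    unfolding mem_so
  proof (intro allI)
    show "(X + Y) $ j $ i = - (X + Y) $ i $ j" for i j
      using so_nth[OF that(1), of j i] so_nth[OF that(2), of j i] by simp
  qed
  show "c *\<^sub>R X \<in> so" if "X \<in> so" for c and X :: "real^'n^'n"
    unfolding mem_so
  proof (intro allI)
    show "(c *\<^sub>R X) $ j $ i = - (c *\<^sub>R X) $ i $ j" for i j
      using so_nth[OF that(1), of j i] by simp
  qed
qed (simp add: mem_so)

lemma lie_bracket_nth: "lie_bracket X Y $ i $ j = (\<Sum>a\<in>UNIV. X $ i $ a * Y $ a $ j - Y $ i $ a * X $ a $ j)"
  by (simp add: lie_bracket_def matrix_matrix_mult_def sum_subtractf)

lemma lie_bracket_so:
  assumes X: "X \<in> so" and Y: "Y \<in> so"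
  shows "lie_bracket X Y \<in> so"
proof -
  have "lie_bracket X Y $ j $ i = - lie_bracket X Y $ i $ j" for i j
    unfolding lie_bracket_nth sum_negf[symmetric]
  proof (rule sum.cong)
    show "X $ j $ a * Y $ a $ i - Y $ j $ a * X $ a $ i
        = - (X $ i $ a * Y $ a $ j - Y $ i $ a * X $ a $ j)" for a
      using so_nth[OF X, of j a] so_nth[OF X, of a i] so_nth[OF Y, of j a] so_nth[OF Y, of a i]
      by simp
  qed simp
  then show ?thesis unfolding mem_so by blast
qed

definition wedge :: "'n::finite \<Rightarrow> 'n \<Rightarrow> real^'n^'n" where
  "wedge i j = matrix_unit i j - matrix_unit j i"

lemma wedge_nth:
  "wedge i j $ a $ b = (if a = i \<and> b = j then 1 else 0) - (if a = j \<and> b = i then 1 else 0)"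
  by (simp add: wedge_def matrix_unit_def)

text \<open>With D saying that two indices are distinct, lie in the same block, or lie in different
  blocks, this is \<open>so\<close>, \<open>\<hh>\<close> or \<open>\<pp>\<close>; one description
  of components and traces then serves them all.\<close>

definition so_on :: "('n \<Rightarrow> 'n \<Rightarrow> bool) \<Rightarrow> (real^'n^'n) set" where
  "so_on D = {A \<in> so. \<forall>i j. \<not> D i j \<longrightarrow> A $ i $ j = 0}"

lemma sum2_delta:
  fixes f :: "'n::finite \<Rightarrow> 'n \<Rightarrow> real"
  shows "(\<Sum>p\<in>UNIV. \<Sum>q\<in>UNIV. if p = i \<and> q = j then f p q else 0) = f i j"
proof -
  have "(\<Sum>q\<in>UNIV. if p = i \<and> q = j then f p q else 0) = (if p = i then f p j else 0)" for p
    by simp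
  then show ?thesis by simp
qed

lemma wedge_so: "wedge i j \<in> so"
  unfolding mem_so wedge_nth by (simp only: minus_diff_eq conj_commute) simp

lemma wedge_so_on:
  assumes "D i j" "D j i"
  shows "wedge i j \<in> so_on D"
proof -
  have "wedge i j $ p $ q = 0" if "\<not> D p q" for p q
  proof -
    have "\<not> (p = i \<and> q = j)" "\<not> (p = j \<and> q = i)"
      using that assms by metis+
    then show ?thesis
      by (simp only: wedge_nth if_False diff_self)
  qed
  then show ?thesis
    using wedge_so[of i j] unfolding so_on_def by blast
qed

lemma subspace_so_on: "subspace (so_on D)"
  using subspace_so unfolding so_on_def subspace_def by auto

text \<open>The projection antisymmetrises and cuts down to D. It sends
  \<open>matrix_unit i j\<close> to half of \<open>wedge i j\<close>, which is the origin of the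
  division by 2: ordered pairs count each basis element twice.\<close>

lemma trace_on_so_on:
  assumes D: "\<And>i j. D i j \<Longrightarrow> D j i"
    and F: "linear F" "\<And>x. x \<in> so_on D \<Longrightarrow> f x = F x" "\<And>x. x \<in> so_on D \<Longrightarrow> F x \<in> so_on D"
  shows "trace_on (so_on D) f = (\<Sum>i\<in>UNIV. \<Sum>j\<in>UNIV. if D i j then F (wedge i j) $ i $ j else 0) / 2"
proof -
  define P :: "real^'a^'a \<Rightarrow> real^'a^'a"
    where "P A = (\<chi> i j. if D i j then (A $ i $ j - A $ j $ i) / 2 else 0)" for A
  have linP: "linear P"
    by (intro linearI) (auto simp: P_def vec_eq_iff field_simps)
  have P_mem: "P A \<in> so_on D" for A
    using D by (auto simp: P_def so_on_def mem_so field_simps)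
  have P_id: "P A = A" if "A \<in> so_on D" for A
  proof -
    have "A \<in> so" "\<And>i j. \<not> D i j \<Longrightarrow> A $ i $ j = 0"
      using that by (auto simp: so_on_def)
    moreover have "A $ j $ i = - A $ i $ j" for i j
      by (rule so_nth) fact
    ultimately have eq: "(if D i j then (A $ i $ j - A $ j $ i) / 2 else 0) = A $ i $ j" for i j
      by (metis diff_minus_eq_add field_sum_of_halves add_divide_distrib)
    show ?thesis
      unfolding P_def vec_eq_iff vec_lambda_beta by (intro allI eq)
  qed
  have "P (matrix_unit i j) = (if D i j then (1/2) *\<^sub>R wedge i j else 0)" for i j
  proof (cases "D i j")
    case True
    moreover from this have "D j i" by (rule D)
    ultimately show ?thesis
      by (auto simp: P_def wedge_def matrix_unit_def vec_eq_iff)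
  next
    case False
    moreover from this have "\<not> D j i" using D by blast
    ultimately show ?thesis
      by (auto simp: P_def matrix_unit_def vec_eq_iff)
  qed
  then have entry: "F (P (matrix_unit i j)) $ i $ j = (if D i j then F (wedge i j) $ i $ j else 0) / 2" for i j
    by (simp add: linear_scale[OF F(1)] linear_0[OF F(1)])
  have "trace_on (so_on D) f = (\<Sum>e\<in>Basis. F (P e) \<bullet> e)"
    by (rule trace_on_eq_sum_Basis[OF subspace_so_on F linP P_mem P_id])
  then show ?thesis
    unfolding sum_Basis_matrix[of "\<lambda>x. F (P x)"] entry sum_divide_distrib .
qed

section \<open>Brackets with \<open>wedge i j\<close> and the Killing form\<close>

lemma lie_bracket_add:
  "lie_bracket (X + Y) Z = lie_bracket X Z + lie_bracket Y Z"
  "lie_bracket Z (X + Y) = lie_bracket Z X + lie_bracket Z Y"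
  by (simp_all only: vec_eq_iff vector_add_component lie_bracket_nth flip: sum.distrib)
    (auto intro!: sum.cong simp: algebra_simps)

lemma lie_bracket_scaleR:
  "lie_bracket (c *\<^sub>R X) Z = c *\<^sub>R lie_bracket X Z"
  "lie_bracket Z (c *\<^sub>R X) = c *\<^sub>R lie_bracket Z X"
  by (simp_all only: vec_eq_iff vector_scaleR_component lie_bracket_nth scaleR_sum_right)
    (auto intro!: sum.cong simp: algebra_simps)

lemma so_diag: "Y \<in> so \<Longrightarrow> Y $ i $ i = 0"
  by (drule so_nth[of _ i i]) linarith

text \<open>Only row i and column j are recorded, because the trace formula looks at the (i,j) entry
  of maps applied to \<open>wedge i j\<close>, and a further bracket reaches that entry through this
  row and this column alone.\<close>

lemma lie_bracket_wedge:
  assumes Y: "Y \<in> so" and "i \<noteq> j"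
  shows "lie_bracket (wedge i j) Y $ i $ a = (if a = i then 0 else Y $ j $ a)"
    and "lie_bracket (wedge i j) Y $ a $ j = (if a = j then 0 else - Y $ a $ i)"
proof -
  have mult: "wedge i j $ b $ c * r
      = (if b = i then if c = j then r else 0 else 0) - (if b = j then if c = i then r else 0 else 0)"
    "r * wedge i j $ b $ c
      = (if c = j then if b = i then r else 0 else 0) - (if c = i then if b = j then r else 0 else 0)"
    for b c r
    by (auto simp: wedge_nth)
  have neg: "Y $ j $ i = - Y $ i $ j"
    by (rule so_nth[OF Y])
  show "lie_bracket (wedge i j) Y $ i $ a = (if a = i then 0 else Y $ j $ a)"
    using \<open>i \<noteq> j\<close> neg so_diag[OF Y]
    by (cases "a = i"; cases "a = j") (simp_all add: lie_bracket_nth sum_subtractf sum.distrib sum_negf mult)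
  show "lie_bracket (wedge i j) Y $ a $ j = (if a = j then 0 else - Y $ a $ i)"
    using \<open>i \<noteq> j\<close> neg so_diag[OF Y]
    by (cases "a = i"; cases "a = j") (simp_all add: lie_bracket_nth sum_subtractf sum.distrib sum_negf mult)
qed

lemma lie_bracket_minus: "lie_bracket X Y = - lie_bracket Y X"
  by (simp add: lie_bracket_def)

text \<open>This is the classical (n - 2) tr(X Y), written with entries: for skew matrices the sum
  over all i, j of X_ij Y_ij equals - tr(X Y).\<close>

lemma killing_form_so:
  fixes X Y :: "real^'n^'n"
  assumes X: "X \<in> so" and Y: "Y \<in> so"
  shows "killing_form so X Y = - (real CARD('n) - 2) * (\<Sum>i\<in>UNIV. \<Sum>j\<in>UNIV. X $ i $ j * Y $ i $ j)"
proof -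
  let ?XY = "\<lambda>i j. X $ i $ j * Y $ i $ j"
  define F where "F Z = lie_bracket X (lie_bracket Y Z)" for Z
  have so: "so = so_on (\<lambda>i j :: 'n. i \<noteq> j)"
    using so_diag by (auto simp: so_on_def)
  have "linear F"
    unfolding F_def by (intro linearI) (simp_all add: lie_bracket_add lie_bracket_scaleR)
  then have "killing_form so X Y
      = (\<Sum>i\<in>UNIV. \<Sum>j\<in>UNIV. if i \<noteq> j then F (wedge i j) $ i $ j else 0) / 2"
    unfolding killing_form_def so
    using lie_bracket_so[OF X] lie_bracket_so[OF Y]
    by (intro trace_on_so_on[where F=F]) (auto simp: F_def so)
  also have "(\<lambda>i j. if i \<noteq> j then F (wedge i j) $ i $ j else 0)
      = (\<lambda>i j. if i \<noteq> j then
          - (\<Sum>a\<in>UNIV. if a \<noteq> j then ?XY i a else 0) - (\<Sum>a\<in>UNIV. if a \<noteq> i then ?XY j a else 0) else 0)"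
  proof (intro ext if_cong refl)
    fix i j :: 'n assume "i \<noteq> j"
    have sum_if: "(\<Sum>a\<in>UNIV. if a \<noteq> j then ?XY i a else 0) + (\<Sum>a\<in>UNIV. if a \<noteq> i then ?XY j a else 0) =
      (\<Sum>a\<in>UNIV. (if a \<noteq> j then ?XY i a else 0) + (if a \<noteq> i then ?XY j a else 0))"
      by (rule sum.distrib[symmetric])
    have "F (wedge i j) $ i $ j
      = (\<Sum>a\<in>UNIV. - ((if a \<noteq> j then ?XY i a else 0) + (if a \<noteq> i then ?XY j a else 0)))"
      unfolding F_def lie_bracket_nth[of X]
    proof (rule sum.cong)
      fix a
      show "X $ i $ a * lie_bracket Y (wedge i j) $ a $ j - lie_bracket Y (wedge i j) $ i $ a * X $ a $ j
        = - ((if a \<noteq> j then ?XY i a else 0) + (if a \<noteq> i then ?XY j a else 0))"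
        using so_nth[OF X, of a j] so_nth[OF Y, of a i] lie_bracket_minus[of Y "wedge i j"]
          lie_bracket_wedge[OF Y \<open>i \<noteq> j\<close>, of a]
          so_diag[OF X, of i] \<open>i \<noteq> j\<close>
        by simp
    qed simp
    then show "F (wedge i j) $ i $ j
      = - (\<Sum>a\<in>UNIV. if a \<noteq> j then ?XY i a else 0) - (\<Sum>a\<in>UNIV. if a \<noteq> i then ?XY j a else 0)"
      unfolding sum_negf using sum_if by linarith
  qed
  \<comment> \<open>Exchanging i and j identifies the two inner sums; the resulting factor 2 cancels
    the halving in the trace formula.\<close>
  also have "(\<Sum>i\<in>UNIV. \<Sum>j\<in>UNIV. if i \<noteq> j then
          - (\<Sum>a\<in>UNIV. if a \<noteq> j then ?XY i a else 0) - (\<Sum>a\<in>UNIV. if a \<noteq> i then ?XY j a else 0) else 0)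
      = - 2 * (\<Sum>i\<in>UNIV. \<Sum>j\<in>UNIV. \<Sum>a\<in>UNIV. if i \<noteq> j \<and> a \<noteq> j then ?XY i a else 0)"
  proof -
    have "(\<Sum>i\<in>UNIV. \<Sum>j\<in>UNIV. \<Sum>a\<in>UNIV. if i \<noteq> j \<and> a \<noteq> j then ?XY i a else 0)
        = (\<Sum>i\<in>UNIV. \<Sum>j\<in>UNIV. \<Sum>a\<in>UNIV. if i \<noteq> j \<and> a \<noteq> i then ?XY j a else 0)"
      by (rule trans[OF sum.swap], intro sum.cong if_cong) auto
    moreover have "(\<Sum>i\<in>UNIV. \<Sum>j\<in>UNIV. if i \<noteq> j then
          - (\<Sum>a\<in>UNIV. if a \<noteq> j then ?XY i a else 0) - (\<Sum>a\<in>UNIV. if a \<noteq> i then ?XY j a else 0) else 0)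
       = (\<Sum>i\<in>UNIV. \<Sum>j\<in>UNIV. - (\<Sum>a\<in>UNIV. if i \<noteq> j \<and> a \<noteq> j then ?XY i a else 0)
           - (\<Sum>a\<in>UNIV. if i \<noteq> j \<and> a \<noteq> i then ?XY j a else 0))"
      by (intro sum.cong refl) simp
    ultimately show ?thesis
      by (simp add: sum_subtractf sum_negf)
  qed
  also have "(\<Sum>i\<in>UNIV. \<Sum>j\<in>UNIV. \<Sum>a\<in>UNIV. if i \<noteq> j \<and> a \<noteq> j then ?XY i a else 0)
      = (\<Sum>i\<in>UNIV. \<Sum>a\<in>UNIV. (real CARD('n) - 2) * ?XY i a)"
  proof (rule sum.cong)
    fix i
    \<comment> \<open>For i and a distinct, j runs over the n - 2 indices different from both; for i
      = a the entry of X vanishes.\<close>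
    have "(\<Sum>j\<in>UNIV. if i \<noteq> j \<and> a \<noteq> j then ?XY i a else 0) = (real CARD('n) - 2) * ?XY i a" for a
    proof (cases "i = a")
      case True
      then have "?XY i a = 0"
        using so_diag[OF X, of a] by simp
      then show ?thesis
        by (simp only: if_cancel) simp
    next
      case False
      then have "card {i, a} = 2" "card {i, a} \<le> CARD('n)"
        by (simp_all only: card_2_iff card_mono finite subset_UNIV) blast
      then have "real (card (- {i, a})) = real CARD('n) - 2"
        by (simp add: Compl_eq_Diff_UNIV card_Diff_subset)
      moreover have "{j. i \<noteq> j \<and> a \<noteq> j} = - {i, a}" by auto
      ultimately show ?thesis
        by (simp add: sum.If_cases)
    qed
    then show "(\<Sum>j\<in>UNIV. \<Sum>a\<in>UNIV. if i \<noteq> j \<and> a \<noteq> j then ?XY i a else 0)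
      = (\<Sum>a\<in>UNIV. (real CARD('n) - 2) * ?XY i a)"
      by (subst sum.swap) simp
  qed simp
  finally show ?thesis
    unfolding sum_distrib_left[symmetric] by (simp only: minus_mult_left[symmetric])
qed

section \<open>Curvature of block diagonal metrics\<close>
text \<open>Uniqueness in the definite description is entrywise: v vanishes where D fails and X - v
  vanishes where D holds. Symmetry of D keeps the truncated matrix skew.\<close>

lemma component_so_on:
  assumes X: "X \<in> so" and D: "\<And>i j. D i j \<Longrightarrow> D j i"
  shows "component (so_on D) (so_on (\<lambda>i j. \<not> D i j)) X = (\<chi> i j. if D i j then X $ i $ j else 0)"
    (is "_ = ?V")
  unfolding component_def
proof (rule the_equality)
  have sym: "D i j = D j i" for i j
    using D[of i j] D[of j i] by blast
  have "?V $ j $ i = - ?V $ i $ j" for i j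
    using so_nth[OF X, of j i] sym[of i j] by simp
  then have V: "?V \<in> so"
    unfolding mem_so by blast
  then show "?V \<in> so_on D \<and> X - ?V \<in> so_on (\<lambda>i j. \<not> D i j)"
    using subspace_diff[OF subspace_so X V] by (simp add: so_on_def)
  fix v assume v: "v \<in> so_on D \<and> X - v \<in> so_on (\<lambda>i j. \<not> D i j)"
  have "v $ i $ j = ?V $ i $ j" for i j
  proof (cases "D i j")
    case True
    then have "(X - v) $ i $ j = 0"
      using v by (simp add: so_on_def)
    then show ?thesis
      using True by simp
  next
    case False
    then show ?thesis
      using v by (simp add: so_on_def)
  qed
  then show "v = ?V"
    by (simp add: vec_eq_iff)
qed

text \<open>Together with the next transposition this generates all permutations of three summation
  indices, which \<open>g_\<Lambda>\<close> needs to bring its triple sums to one form.\<close>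

lemma sum3_swap12:
  fixes f :: "'n::finite \<Rightarrow> 'n \<Rightarrow> 'n \<Rightarrow> real"
  shows "(\<Sum>i\<in>UNIV. \<Sum>j\<in>UNIV. \<Sum>a\<in>UNIV. f i j a) = (\<Sum>i\<in>UNIV. \<Sum>j\<in>UNIV. \<Sum>a\<in>UNIV. f j i a)"
  by (rule sum.swap)

lemma sum3_swap23:
  fixes f :: "'n::finite \<Rightarrow> 'n \<Rightarrow> 'n \<Rightarrow> real"
  shows "(\<Sum>i\<in>UNIV. \<Sum>j\<in>UNIV. \<Sum>a\<in>UNIV. f i j a) = (\<Sum>i\<in>UNIV. \<Sum>j\<in>UNIV. \<Sum>a\<in>UNIV. f i a j)"
  by (rule sum.cong[OF refl], rule sum.swap)

text \<open>The curvature computation is carried out for arbitrary block labels and a positive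
  symmetric weight on each pair of indices. Three blocks and the parameters x1, x2, x3 enter only
  when the resulting sums are evaluated.\<close>

locale block_metric =
  fixes \<beta> :: "'n::finite \<Rightarrow> nat" and w :: "'n \<Rightarrow> 'n \<Rightarrow> real" and \<nu> :: real
    and g :: "real^'n^'n \<Rightarrow> real^'n^'n \<Rightarrow> real" and \<hh> \<pp> :: "(real^'n^'n) set"
  assumes w_sym: "w i j = w j i" and w_pos: "w i j > 0" and \<nu>_pos: "\<nu> > 0"
    and \<pp>_def: "\<pp> = so_on (\<lambda>i j. \<beta> i \<noteq> \<beta> j)"
    and \<hh>_def: "\<hh> = so_on (\<lambda>i j. \<not> (\<beta> i \<noteq> \<beta> j))"
    and g_eq: "X \<in> \<pp> \<Longrightarrow> Y \<in> \<pp> \<Longrightarrow> g X Y = \<nu> * (\<Sum>i\<in>UNIV. \<Sum>j\<in>UNIV. w i j * (X $ i $ j * Y $ i $ j))"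
begin

lemma subspace_\<pp>: "subspace \<pp>"
  unfolding \<pp>_def by (rule subspace_so_on)

lemma \<pp>_so: "X \<in> \<pp> \<Longrightarrow> X \<in> so"
  by (simp add: \<pp>_def so_on_def)

lemma \<pp>_nth: "X \<in> \<pp> \<Longrightarrow> X $ j $ i = - X $ i $ j"
  by (rule so_nth[OF \<pp>_so])

lemma \<pp>_zero: "X \<in> \<pp> \<Longrightarrow> \<beta> i = \<beta> j \<Longrightarrow> X $ i $ j = 0"
  by (simp add: \<pp>_def so_on_def)

lemma \<pp>I: "(\<And>i j. X $ j $ i = - X $ i $ j) \<Longrightarrow> (\<And>i j. \<beta> i = \<beta> j \<Longrightarrow> X $ i $ j = 0) \<Longrightarrow> X \<in> \<pp>"
  unfolding \<pp>_def so_on_def mem_Collect_eq mem_so by blast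

definition off :: "real^'n^'n \<Rightarrow> real^'n^'n" where
  "off X = (\<chi> i j. if \<beta> i \<noteq> \<beta> j then X $ i $ j else 0)"

lemma component_\<pp>: "X \<in> so \<Longrightarrow> component \<pp> \<hh> X = off X"
  unfolding \<pp>_def \<hh>_def off_def by (rule component_so_on) auto

lemma component_\<hh>: 
  assumes "X \<in> so"
  shows "component \<hh> \<pp> X = X - off X"
proof -
  have "component \<hh> \<pp> X = (\<chi> i j. if \<not> (\<beta> i \<noteq> \<beta> j) then X $ i $ j else 0)"
    unfolding \<pp>_def \<hh>_def
    using component_so_on[OF assms, of "\<lambda>i j. \<not> (\<beta> i \<noteq> \<beta> j)"] by simp
  then show ?thesis
    by (simp add: off_def vec_eq_iff)
qed

lemma off_\<pp>:
  assumes "X \<in> so"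
  shows "off X \<in> \<pp>"
proof (rule \<pp>I)
  show "off X $ j $ i = - off X $ i $ j" for i j
    using so_nth[OF assms, of j i] by (simp add: off_def)
qed (simp add: off_def)

text \<open>Coefficient of X_ia Y_aj in the (i,j) entry of 2 \<open>\<Lambda> X Y\<close>. In the
  defining equation [X,Y] contributes \<open>w i j\<close> and the other two brackets contribute
  \<open>w a j\<close> and - \<open>w i a\<close>. If i, a or a, j share a block, the product
  vanishes on \<open>\<pp>\<close> anyway; the value 0 for i, j in one block puts the image into
  \<open>\<pp>\<close>.\<close>

definition \<alpha> :: "'n \<Rightarrow> 'n \<Rightarrow> 'n \<Rightarrow> real" where
  "\<alpha> i a j = (if \<beta> i \<noteq> \<beta> a \<and> \<beta> a \<noteq> \<beta> j \<and> \<beta> i \<noteq> \<beta> j then (w i j + w a j - w i a) / w i j else 0)"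

text \<open>The Levi-Civita map, obtained by solving its defining equation with the trace form.\<close>

definition \<Lambda> :: "real^'n^'n \<Rightarrow> real^'n^'n \<Rightarrow> real^'n^'n" where
  "\<Lambda> X Y = (\<chi> i j. (\<Sum>a\<in>UNIV. \<alpha> i a j * (X $ i $ a * Y $ a $ j) - \<alpha> j a i * (Y $ i $ a * X $ a $ j)) / 2)"

lemma \<Lambda>_\<pp>:
  assumes X: "X \<in> \<pp>" and Y: "Y \<in> \<pp>"
  shows "\<Lambda> X Y \<in> \<pp>"
proof (rule \<pp>I)
  show "\<Lambda> X Y $ j $ i = - \<Lambda> X Y $ i $ j" for i j
  proof -
    have "(\<Sum>a\<in>UNIV. \<alpha> j a i * (X $ j $ a * Y $ a $ i) - \<alpha> i a j * (Y $ j $ a * X $ a $ i))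
        = (\<Sum>a\<in>UNIV. - (\<alpha> i a j * (X $ i $ a * Y $ a $ j) - \<alpha> j a i * (Y $ i $ a * X $ a $ j)))"
    proof (rule sum.cong)
      fix a
      show "\<alpha> j a i * (X $ j $ a * Y $ a $ i) - \<alpha> i a j * (Y $ j $ a * X $ a $ i)
          = - (\<alpha> i a j * (X $ i $ a * Y $ a $ j) - \<alpha> j a i * (Y $ i $ a * X $ a $ j))"
        unfolding \<pp>_nth[OF X, of j a] \<pp>_nth[OF X, of a i] \<pp>_nth[OF Y, of j a] \<pp>_nth[OF Y, of a i]
        by simp
    qed simp
    then show ?thesis
      unfolding sum_negf by (simp add: \<Lambda>_def)
  qed
  show "\<Lambda> X Y $ i $ j = 0" if "\<beta> i = \<beta> j" for i j
    using that by (simp add: \<Lambda>_def \<alpha>_def)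
qed

text \<open>Every term is reindexed to a triple sum over the same monomial t = X_ia Y_aj Z_ij, skew
  symmetry supplying the signs, and the coefficients are compared.\<close>

lemma g_\<Lambda>:
  assumes X: "X \<in> \<pp>" and Y: "Y \<in> \<pp>" and Z: "Z \<in> \<pp>"
  shows "2 * g (\<Lambda> X Y) Z = g (off (lie_bracket X Y)) Z + g (off (lie_bracket Z X)) Y + g X (off (lie_bracket Z Y))"
proof -
  define t where "t i j a = X $ i $ a * Y $ a $ j * Z $ i $ j" for i j a
  let ?S = "\<lambda>f :: 'n \<Rightarrow> 'n \<Rightarrow> 'n \<Rightarrow> real. \<Sum>i\<in>UNIV. \<Sum>j\<in>UNIV. \<Sum>a\<in>UNIV. f i j a"
  have sw12: "?S f = ?S (\<lambda>i j a. f j i a)" for f by (rule sum3_swap12)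
  have sw23: "?S f = ?S (\<lambda>i j a. f i a j)" for f by (rule sum3_swap23)
  have rot: "?S f = ?S (\<lambda>i j a. f a i j)" for f
    by (rule trans[OF sw12[of f] sw23[of "\<lambda>i j a. f j i a"]])
  have rot': "?S f = ?S (\<lambda>i j a. f j a i)" for f
    by (rule rot[of "\<lambda>i j a. f j a i", symmetric])
  have sw13: "?S f = ?S (\<lambda>i j a. f a j i)" for f
    by (rule trans[OF sw12[of f] rot'[of "\<lambda>i j a. f j i a"]])
  note Xn = \<pp>_nth[OF X] and Yn = \<pp>_nth[OF Y] and Zn = \<pp>_nth[OF Z]
  have add: "?S (\<lambda>i j a. f i j a + h i j a) = ?S f + ?S h" for f h
    by (simp add: sum.distrib)
  have lhs: "2 * g (\<Lambda> X Y) Z = \<nu> * (2 * ?S (\<lambda>i j a. w i j * \<alpha> i a j * t i j a))"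
  proof -
    have "2 * g (\<Lambda> X Y) Z = \<nu> * ?S (\<lambda>i j a. w i j * \<alpha> i a j * t i j a + - (w i j * \<alpha> j a i * (Y $ i $ a * X $ a $ j * Z $ i $ j)))"
    proof -
      have entry: "w i j * (\<Lambda> X Y $ i $ j * Z $ i $ j)
        = (\<Sum>a\<in>UNIV. w i j * \<alpha> i a j * t i j a + - (w i j * \<alpha> j a i * (Y $ i $ a * X $ a $ j * Z $ i $ j))) / 2" for i j
        by (simp add: \<Lambda>_def sum_distrib_left sum_distrib_right t_def algebra_simps)
      show ?thesis
        unfolding g_eq[OF \<Lambda>_\<pp>[OF X Y] Z] entry by (simp flip: sum_divide_distrib)
    qed
    also have "\<dots> = \<nu> * (?S (\<lambda>i j a. w i j * \<alpha> i a j * t i j a) + ?S (\<lambda>i j a. - (w i j * \<alpha> j a i * (Y $ i $ a * X $ a $ j * Z $ i $ j))))"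
      by (simp only: add)
    also have "?S (\<lambda>i j a. - (w i j * \<alpha> j a i * (Y $ i $ a * X $ a $ j * Z $ i $ j)))
      = ?S (\<lambda>i j a. - (w j i * \<alpha> i a j * (Y $ j $ a * X $ a $ i * Z $ j $ i)))"
      by (rule sw12)
    also have "(\<lambda>i j a. - (w j i * \<alpha> i a j * (Y $ j $ a * X $ a $ i * Z $ j $ i))) = (\<lambda>i j a. w i j * \<alpha> i a j * t i j a)"
    proof (intro ext)
      fix i j a
      show "- (w j i * \<alpha> i a j * (Y $ j $ a * X $ a $ i * Z $ j $ i)) = w i j * \<alpha> i a j * t i j a"
        using Yn[of j a] Xn[of a i] Zn[of j i] w_sym[of i j] by (simp add: t_def)
    qed
    finally show ?thesis by simp
  qed
  have expand: "g (off (lie_bracket U V)) W = \<nu> * (?S (\<lambda>i j a. w i j * (U $ i $ a * V $ a $ j * W $ i $ j))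
       + ?S (\<lambda>i j a. - (w i j * (V $ i $ a * U $ a $ j * W $ i $ j))))"
    if "U \<in> \<pp>" "V \<in> \<pp>" "W \<in> \<pp>" for U V W
  proof -
    have off_W: "off M $ i $ j * W $ i $ j = M $ i $ j * W $ i $ j" for M i j
      using \<pp>_zero[OF that(3), of i j] by (simp add: off_def)
    have "g (off (lie_bracket U V)) W = \<nu> * (\<Sum>i\<in>UNIV. \<Sum>j\<in>UNIV. w i j * (lie_bracket U V $ i $ j * W $ i $ j))"
      unfolding g_eq[OF off_\<pp>[OF lie_bracket_so[OF \<pp>_so[OF that(1)] \<pp>_so[OF that(2)]]] that(3)] by (simp only: off_W)
    also have "\<dots> = \<nu> * ?S (\<lambda>i j a. w i j * (U $ i $ a * V $ a $ j * W $ i $ j) + - (w i j * (V $ i $ a * U $ a $ j * W $ i $ j)))"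
      by (simp add: lie_bracket_nth sum_distrib_left sum_distrib_right algebra_simps)
    finally show ?thesis by (simp only: add)
  qed
  \<comment> \<open>Each of the three brackets consists of two products. After reindexing both give
    the same sum, with coefficient \<open>w i j\<close> (r1, r2), \<open>w a j\<close> (r3, r4) and
    - \<open>w i a\<close> (r5, r6).\<close>
  have r1: "?S (\<lambda>i j a. w i j * (X $ i $ a * Y $ a $ j * Z $ i $ j)) = ?S (\<lambda>i j a. w i j * t i j a)"
    by (simp add: t_def)
  have r2: "?S (\<lambda>i j a. - (w i j * (Y $ i $ a * X $ a $ j * Z $ i $ j))) = ?S (\<lambda>i j a. w i j * t i j a)"
    unfolding sw12[of "\<lambda>i j a. - (w i j * (Y $ i $ a * X $ a $ j * Z $ i $ j))"]
  proof (intro sum.cong refl)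
    fix i j a
    show "- (w j i * (Y $ j $ a * X $ a $ i * Z $ j $ i)) = w i j * t i j a"
      using Yn[of j a] Xn[of a i] Zn[of j i] w_sym[of i j] by (simp add: t_def)
  qed
  have r3: "?S (\<lambda>i j a. w i j * (Z $ i $ a * X $ a $ j * Y $ i $ j)) = ?S (\<lambda>i j a. w a j * t i j a)"
    unfolding rot'[of "\<lambda>i j a. w i j * (Z $ i $ a * X $ a $ j * Y $ i $ j)"]
  proof (intro sum.cong refl)
    fix i j a
    show "w j a * (Z $ j $ i * X $ i $ a * Y $ j $ a) = w a j * t i j a"
      using Yn[of j a] Zn[of j i] w_sym[of a j] by (simp add: t_def)
  qed
  have r4: "?S (\<lambda>i j a. - (w i j * (X $ i $ a * Z $ a $ j * Y $ i $ j))) = ?S (\<lambda>i j a. w a j * t i j a)"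
    unfolding sw13[of "\<lambda>i j a. - (w i j * (X $ i $ a * Z $ a $ j * Y $ i $ j))"]
  proof (intro sum.cong refl)
    fix i j a
    show "- (w a j * (X $ a $ i * Z $ i $ j * Y $ a $ j)) = w a j * t i j a"
      using Xn[of a i] by (simp add: t_def)
  qed
  have r5: "?S (\<lambda>i j a. w i j * (Z $ i $ a * Y $ a $ j * X $ i $ j)) = ?S (\<lambda>i j a. - (w i a * t i j a))"
    unfolding sw23[of "\<lambda>i j a. w i j * (Z $ i $ a * Y $ a $ j * X $ i $ j)"]
  proof (intro sum.cong refl)
    fix i j a
    show "w i a * (Z $ i $ j * Y $ j $ a * X $ i $ a) = - (w i a * t i j a)"
      using Yn[of j a] by (simp add: t_def)
  qed
  have r6: "?S (\<lambda>i j a. - (w i j * (Y $ i $ a * Z $ a $ j * X $ i $ j))) = ?S (\<lambda>i j a. - (w i a * t i j a))"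
    unfolding rot[of "\<lambda>i j a. - (w i j * (Y $ i $ a * Z $ a $ j * X $ i $ j))"]
  proof (intro sum.cong refl)
    fix i j a
    show "- (w a i * (Y $ a $ j * Z $ j $ i * X $ a $ i)) = - (w i a * t i j a)"
      using Xn[of a i] Zn[of j i] w_sym[of a i] by (simp add: t_def)
  qed
  have g_commute: "g X V = g V X" if "V \<in> \<pp>" for V
    using g_eq[OF X that] g_eq[OF that X] by (simp add: mult.commute)
  \<comment> \<open>If two of the three labels agree, one of the factors X_ia, Y_aj, Z_ij is zero,
    so the value 0 of \<open>\<alpha>\<close> is harmless.\<close>
  have main: "?S (\<lambda>i j a. w i j * \<alpha> i a j * t i j a)
      = ?S (\<lambda>i j a. w i j * t i j a + w a j * t i j a + - (w i a * t i j a))"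
  proof (intro sum.cong refl)
    fix i j a
    show "w i j * \<alpha> i a j * t i j a = w i j * t i j a + w a j * t i j a + - (w i a * t i j a)"
    proof (cases "\<beta> i \<noteq> \<beta> a \<and> \<beta> a \<noteq> \<beta> j \<and> \<beta> i \<noteq> \<beta> j")
      case True
      then have eq: "w i j * \<alpha> i a j = w i j + w a j - w i a"
        using w_pos[of i j] by (simp add: \<alpha>_def)
      show ?thesis
        unfolding eq by (simp add: algebra_simps)
    next
      case False
      then have "t i j a = 0"
        using \<pp>_zero[OF X, of i a] \<pp>_zero[OF Y, of a j] \<pp>_zero[OF Z, of i j] by (auto simp: t_def)
      then show ?thesis by simp
    qed
  qed
  show ?thesis
    unfolding lhs main g_commute[OF off_\<pp>[OF lie_bracket_so[OF \<pp>_so[OF Z] \<pp>_so[OF Y]]]]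
      expand[OF X Y Z] expand[OF Z X Y] expand[OF Z Y X] r1 r2 r3 r4 r5 r6 add
    by (simp add: algebra_simps)
qed

text \<open>Existence is \<open>g_\<Lambda>\<close>. For uniqueness, the difference of two solutions
  is tested against itself, and positivity of the weights makes all of its entries vanish.\<close>

lemma levi_civita_eq:
  assumes X: "X \<in> \<pp>" and Y: "Y \<in> \<pp>"
  shows "levi_civita \<hh> \<pp> g X Y = \<Lambda> X Y"
proof -
  have comp: "component \<pp> \<hh> (lie_bracket U V) = off (lie_bracket U V)" if "U \<in> \<pp>" "V \<in> \<pp>" for U V
    using that by (intro component_\<pp> lie_bracket_so \<pp>_so)
  show ?thesis
    unfolding levi_civita_def
  proof (rule the_equality)
    show "\<Lambda> X Y \<in> \<pp> \<and> (\<forall>Z\<in>\<pp>. 2 * g (\<Lambda> X Y) Z = g (component \<pp> \<hh> (lie_bracket X Y)) Z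
        + g (component \<pp> \<hh> (lie_bracket Z X)) Y + g X (component \<pp> \<hh> (lie_bracket Z Y)))"
      using X Y by (simp add: comp \<Lambda>_\<pp> g_\<Lambda>)
  next
    fix W assume W: "W \<in> \<pp> \<and> (\<forall>Z\<in>\<pp>. 2 * g W Z = g (component \<pp> \<hh> (lie_bracket X Y)) Z
        + g (component \<pp> \<hh> (lie_bracket Z X)) Y + g X (component \<pp> \<hh> (lie_bracket Z Y)))"
    define V where "V = W - \<Lambda> X Y"
    have V: "V \<in> \<pp>"
      using W \<Lambda>_\<pp>[OF X Y] subspace_diff[OF subspace_\<pp>] by (simp add: V_def)
    have "g W V = g (\<Lambda> X Y) V"
      using W[THEN conjunct2, rule_format, OF V] g_\<Lambda>[OF X Y V] by (simp add: comp V X Y)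
    then have "(\<Sum>i\<in>UNIV. \<Sum>j\<in>UNIV. w i j * (W $ i $ j * V $ i $ j))
        = (\<Sum>i\<in>UNIV. \<Sum>j\<in>UNIV. w i j * (\<Lambda> X Y $ i $ j * V $ i $ j))"
      using \<nu>_pos g_eq[OF W[THEN conjunct1] V] g_eq[OF \<Lambda>_\<pp>[OF X Y] V] by simp
    moreover have "w i j * (V $ i $ j * V $ i $ j)
        = w i j * (W $ i $ j * V $ i $ j) - w i j * (\<Lambda> X Y $ i $ j * V $ i $ j)" for i j
      by (simp add: V_def algebra_simps)
    ultimately have "(\<Sum>i\<in>UNIV. \<Sum>j\<in>UNIV. w i j * (V $ i $ j * V $ i $ j)) = 0"
      by (simp only: sum_subtractf diff_self)
    moreover have "0 \<le> w i j * (V $ i $ j * V $ i $ j)" for i j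
      using w_pos[of i j] by simp
    ultimately have "w i j * (V $ i $ j * V $ i $ j) = 0" for i j
      by (simp add: sum_nonneg_eq_0_iff sum_nonneg)
    then have "V $ i $ j = 0" for i j
      using w_pos[of i j] by (metis mult_eq_0_iff order_less_irrefl)
    then show "W = \<Lambda> X Y"
      by (simp add: V_def vec_eq_iff)
  qed
qed

section \<open>Linearity, the curvature tensor and its trace\<close>

lemma \<Lambda>_add: "\<Lambda> (X + Y) Z = \<Lambda> X Z + \<Lambda> Y Z" "\<Lambda> Z (X + Y) = \<Lambda> Z X + \<Lambda> Z Y"
  by (simp_all only: \<Lambda>_def vec_eq_iff vector_add_component vec_lambda_beta
      flip: sum.distrib add_divide_distrib)
    (auto intro!: sum.cong arg_cong[where f="\<lambda>x. x / 2"] simp: algebra_simps)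

lemma \<Lambda>_scaleR: "\<Lambda> (c *\<^sub>R X) Z = c *\<^sub>R \<Lambda> X Z" "\<Lambda> Z (c *\<^sub>R X) = c *\<^sub>R \<Lambda> Z X"
  by (simp_all only: \<Lambda>_def vec_eq_iff vector_scaleR_component vec_lambda_beta real_scaleR_def
      times_divide_eq_right sum_distrib_left)
    (auto intro!: sum.cong arg_cong[where f="\<lambda>x. x / 2"] simp: algebra_simps)

lemma off_add: "off (X + Y) = off X + off Y"
  by (simp add: off_def vec_eq_iff)

lemma off_scaleR: "off (c *\<^sub>R X) = c *\<^sub>R off X"
  by (simp add: off_def vec_eq_iff)

text \<open>A version of \<open>curvature\<close> without definite descriptions. It is linear in X
  on all matrices, as the trace formula requires;
  \<open>lie_bracket X Y - off (lie_bracket X Y)\<close> is the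
  \<open>\<hh>\<close>-component.\<close>

definition R :: "real^'n^'n \<Rightarrow> real^'n^'n \<Rightarrow> real^'n^'n \<Rightarrow> real^'n^'n" where
  "R X Y Z = \<Lambda> X (\<Lambda> Y Z) - \<Lambda> Y (\<Lambda> X Z) - \<Lambda> (off (lie_bracket X Y)) Z
     - lie_bracket (lie_bracket X Y - off (lie_bracket X Y)) Z"

lemma curvature_eq:
  assumes "X \<in> \<pp>" "Y \<in> \<pp>" "Z \<in> \<pp>"
  shows "curvature \<hh> \<pp> g X Y Z = R X Y Z"
proof -
  have "lie_bracket X Y \<in> so"
    using assms by (intro lie_bracket_so \<pp>_so)
  then show ?thesis
    using assms
    by (simp add: curvature_def R_def levi_civita_eq \<Lambda>_\<pp> component_\<pp> component_\<hh> off_\<pp>)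
qed

lemma linear_R: "linear (\<lambda>X. R X Y Z)"
  unfolding R_def
proof (intro linear_compose_sub)
  have br: "linear (\<lambda>X. lie_bracket X U)" for U :: "real^'n^'n"
    by (rule linearI) (simp_all only: lie_bracket_add lie_bracket_scaleR)
  have off: "linear off"
    by (rule linearI) (simp_all only: off_add off_scaleR)
  have \<Lambda>1: "linear (\<lambda>X. \<Lambda> X U)" and \<Lambda>2: "linear (\<lambda>X. \<Lambda> U X)" for U :: "real^'n^'n"
    by (rule linearI; simp only: \<Lambda>_add \<Lambda>_scaleR)+
  show "linear (\<lambda>X. \<Lambda> X (\<Lambda> Y Z))"
    by (rule \<Lambda>1)
  show "linear (\<lambda>X. \<Lambda> Y (\<Lambda> X Z))"
    using linear_compose[OF \<Lambda>1[of Z] \<Lambda>2[of Y]] by (simp add: o_def)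
  have off_br: "linear (\<lambda>X. off (lie_bracket X Y))"
    using linear_compose[OF br off] by (simp add: o_def)
  show "linear (\<lambda>X. \<Lambda> (off (lie_bracket X Y)) Z)"
    using linear_compose[OF off_br \<Lambda>1[of Z]] by (simp add: o_def)
  show "linear (\<lambda>X. lie_bracket (lie_bracket X Y - off (lie_bracket X Y)) Z)"
    using linear_compose[OF linear_compose_sub[OF br off_br] br[of Z]] by (simp add: o_def)
qed

text \<open>Reductivity of the decomposition. For i and j in one block, an intermediate index a in
  that block annihilates the entries of Z, and any other a annihilates the entries of H.\<close>

lemma lie_bracket_\<hh>_\<pp>:
  assumes H: "H \<in> so" "\<And>i j. \<beta> i \<noteq> \<beta> j \<Longrightarrow> H $ i $ j = 0" and Z: "Z \<in> \<pp>"
  shows "lie_bracket H Z \<in> \<pp>"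
proof (rule \<pp>I)
  show "lie_bracket H Z $ j $ i = - lie_bracket H Z $ i $ j" for i j
    by (intro so_nth lie_bracket_so H \<pp>_so Z)
  show "lie_bracket H Z $ i $ j = 0" if "\<beta> i = \<beta> j" for i j
    unfolding lie_bracket_nth
  proof (rule sum.neutral, intro ballI)
    fix a
    show "H $ i $ a * Z $ a $ j - Z $ i $ a * H $ a $ j = 0"
    proof (cases "\<beta> i = \<beta> a")
      case True
      then have "Z $ a $ j = 0" "Z $ i $ a = 0"
        using that by (auto intro: \<pp>_zero[OF Z])
      then show ?thesis by simp
    next
      case False
      then have "H $ i $ a = 0" "H $ a $ j = 0"
        using that by (auto intro: H(2))
      then show ?thesis by simp
    qed
  qed
qed

lemma R_\<pp>:
  assumes "X \<in> \<pp>" "Y \<in> \<pp>" "Z \<in> \<pp>"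
  shows "R X Y Z \<in> \<pp>"
proof -
  have so: "lie_bracket X Y \<in> so"
    using assms by (intro lie_bracket_so \<pp>_so)
  have "lie_bracket X Y - off (lie_bracket X Y) \<in> so"
    by (rule subspace_diff[OF subspace_so so \<pp>_so[OF off_\<pp>[OF so]]])
  moreover have "(lie_bracket X Y - off (lie_bracket X Y)) $ i $ j = 0" if "\<beta> i \<noteq> \<beta> j" for i j
    using that by (simp add: off_def)
  ultimately have "lie_bracket (lie_bracket X Y - off (lie_bracket X Y)) Z \<in> \<pp>"
    using assms(3) by (rule lie_bracket_\<hh>_\<pp>)
  then show ?thesis
    unfolding R_def using assms so
    by (intro subspace_diff[OF subspace_\<pp>] \<Lambda>_\<pp> off_\<pp>)
qed

lemma ricci_eq_sum_R:
  assumes "Y \<in> \<pp>" "Z \<in> \<pp>"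
  shows "ricci \<hh> \<pp> g Y Z = (\<Sum>i\<in>UNIV. \<Sum>j\<in>UNIV. if \<beta> i \<noteq> \<beta> j then R (wedge i j) Y Z $ i $ j else 0) / 2"
proof -
  have "trace_on \<pp> (\<lambda>X. curvature \<hh> \<pp> g X Y Z)
    = (\<Sum>i\<in>UNIV. \<Sum>j\<in>UNIV. if \<beta> i \<noteq> \<beta> j then R (wedge i j) Y Z $ i $ j else 0) / 2"
    unfolding \<pp>_def
    by (rule trace_on_so_on[OF _ linear_R])
      (use assms in \<open>auto simp: curvature_eq R_\<pp> simp flip: \<pp>_def\<close>)
  then show ?thesis
    by (simp only: ricci_def)
qed

text \<open>Disposes of the term \<open>\<Lambda> X (\<Lambda> Y Z)\<close> of the curvature. The
  entry of \<open>wedge i j\<close> is nonzero only at a = j in the first product and a = i in the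
  second, where the coefficient \<open>\<alpha>\<close> has two equal labels.\<close>

lemma \<Lambda>_wedge:
  assumes "\<beta> i \<noteq> \<beta> j"
  shows "\<Lambda> (wedge i j) V $ i $ j = 0"
proof -
  have "\<alpha> i a j * (wedge i j $ i $ a * V $ a $ j) - \<alpha> j a i * (V $ i $ a * wedge i j $ a $ j) = 0" for a
    using assms by (cases "a = j"; cases "a = i") (simp_all add: wedge_nth \<alpha>_def)
  then show ?thesis
    unfolding \<Lambda>_def vec_lambda_beta by (simp only: sum.neutral_const div_0)
qed

text \<open>The factor \<open>\<alpha> i a j\<close> confines a to a block different from those of i
  and j; there row a of \<open>wedge i j\<close> is zero and its column j leaves only the summand b
  = i.\<close>

lemma \<alpha>_wedge_left:
  assumes "\<beta> i \<noteq> \<beta> j"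
  shows "\<alpha> i a j * \<Lambda> (wedge i j) Z $ a $ j = - (\<alpha> i a j * \<alpha> j i a * Z $ a $ i) / 2"
proof (cases "\<beta> i \<noteq> \<beta> a \<and> \<beta> a \<noteq> \<beta> j")
  case True
  have "(\<Sum>b\<in>UNIV. \<alpha> a b j * (wedge i j $ a $ b * Z $ b $ j) - \<alpha> j b a * (Z $ a $ b * wedge i j $ b $ j))
      = (\<Sum>b\<in>UNIV. if b = i then - (\<alpha> j i a * Z $ a $ i) else 0)"
  proof (rule sum.cong)
    fix b
    show "\<alpha> a b j * (wedge i j $ a $ b * Z $ b $ j) - \<alpha> j b a * (Z $ a $ b * wedge i j $ b $ j)
        = (if b = i then - (\<alpha> j i a * Z $ a $ i) else 0)"
    proof -
      have ne: "a \<noteq> i" "a \<noteq> j" "j \<noteq> i"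
        using assms True by auto
      have "wedge i j $ a $ b = 0" "wedge i j $ b $ j = (if b = i then 1 else 0)"
        by (simp_all add: wedge_nth ne)
      then show ?thesis by simp
    qed
  qed simp
  then show ?thesis
    by (simp add: \<Lambda>_def)
next
  case False
  then have "\<alpha> i a j = 0"
    by (auto simp: \<alpha>_def)
  then show ?thesis by simp
qed

lemma \<alpha>_wedge_right:
  assumes "\<beta> i \<noteq> \<beta> j"
  shows "\<alpha> j a i * \<Lambda> (wedge i j) Z $ i $ a = \<alpha> j a i * \<alpha> i j a * Z $ j $ a / 2"
proof (cases "\<beta> i \<noteq> \<beta> a \<and> \<beta> a \<noteq> \<beta> j")
  case True
  have "(\<Sum>b\<in>UNIV. \<alpha> i b a * (wedge i j $ i $ b * Z $ b $ a) - \<alpha> a b i * (Z $ i $ b * wedge i j $ b $ a))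
      = (\<Sum>b\<in>UNIV. if b = j then \<alpha> i j a * Z $ j $ a else 0)"
  proof (rule sum.cong)
    fix b
    show "\<alpha> i b a * (wedge i j $ i $ b * Z $ b $ a) - \<alpha> a b i * (Z $ i $ b * wedge i j $ b $ a)
        = (if b = j then \<alpha> i j a * Z $ j $ a else 0)"
    proof -
      have ne: "a \<noteq> i" "a \<noteq> j" "i \<noteq> j"
        using assms True by auto
      have "wedge i j $ b $ a = 0" "wedge i j $ i $ b = (if b = j then 1 else 0)"
        by (simp_all add: wedge_nth ne)
      then show ?thesis by simp
    qed
  qed simp
  then show ?thesis
    by (simp add: \<Lambda>_def)
next
  case False
  then have "\<alpha> j a i = 0"
    by (auto simp: \<alpha>_def)
  then show ?thesis by simp
qed

text \<open>Coefficient of Y_ia Z_ia in the (i,j) entry of \<open>R (wedge i j) Y Z\<close>. The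
  three summands come from the term with the \<open>\<pp>\<close>-component of the bracket, from
  \<open>\<Lambda> Y (\<Lambda> X Z)\<close>, and from the isotropy term.\<close>

definition \<kappa> :: "'n \<Rightarrow> 'n \<Rightarrow> 'n \<Rightarrow> real" where
  "\<kappa> i j a = \<alpha> j a i / 2 - \<alpha> i a j * \<alpha> j i a / 4 + (if \<beta> a = \<beta> j \<and> a \<noteq> j then 1 else 0)"

text \<open>Each of the three surviving curvature terms pairs row i of Y with row i of Z or row j
  with row j, never a mixture, and the two kinds are exchanged by exchanging i and j.\<close>

lemma R_wedge:
  assumes ij: "\<beta> i \<noteq> \<beta> j" and Y: "Y \<in> \<pp>" and Z: "Z \<in> \<pp>"
  shows "R (wedge i j) Y Z $ i $ j = (\<Sum>a\<in>UNIV. \<kappa> i j a * (Y $ i $ a * Z $ i $ a))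
     + (\<Sum>a\<in>UNIV. \<kappa> j i a * (Y $ j $ a * Z $ j $ a))"
proof -
  have "i \<noteq> j" using ij by auto
  note br = lie_bracket_wedge[OF \<pp>_so[OF Y] this]
  let ?C = "lie_bracket (wedge i j) Y"
  define H where "H = ?C - off ?C"
  have \<Lambda>\<Lambda>: "\<Lambda> Y (\<Lambda> (wedge i j) Z) $ i $ j
    = (\<Sum>a\<in>UNIV. (\<alpha> i a j * \<alpha> j i a * (Y $ i $ a * Z $ i $ a) + \<alpha> j a i * \<alpha> i j a * (Y $ j $ a * Z $ j $ a)) / 4)"
    unfolding \<Lambda>_def[of Y] vec_lambda_beta sum_divide_distrib
  proof (rule sum.cong)
    fix a
    have "\<alpha> i a j * (Y $ i $ a * \<Lambda> (wedge i j) Z $ a $ j) - \<alpha> j a i * (\<Lambda> (wedge i j) Z $ i $ a * Y $ a $ j)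
      = Y $ i $ a * (\<alpha> i a j * \<Lambda> (wedge i j) Z $ a $ j) - (\<alpha> j a i * \<Lambda> (wedge i j) Z $ i $ a) * Y $ a $ j"
      by simp
    then show "(\<alpha> i a j * (Y $ i $ a * \<Lambda> (wedge i j) Z $ a $ j) - \<alpha> j a i * (\<Lambda> (wedge i j) Z $ i $ a * Y $ a $ j)) / 2
      = (\<alpha> i a j * \<alpha> j i a * (Y $ i $ a * Z $ i $ a) + \<alpha> j a i * \<alpha> i j a * (Y $ j $ a * Z $ j $ a)) / 4"
      unfolding \<alpha>_wedge_left[OF ij] \<alpha>_wedge_right[OF ij] \<pp>_nth[OF Y, of a j] \<pp>_nth[OF Z, of a i]
      by (simp add: field_simps)
  qed simp
  have \<Lambda>off: "\<Lambda> (off ?C) Z $ i $ j = (\<Sum>a\<in>UNIV. - (\<alpha> i a j * (Y $ j $ a * Z $ j $ a) + \<alpha> j a i * (Y $ i $ a * Z $ i $ a)) / 2)"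
    unfolding \<Lambda>_def vec_lambda_beta sum_divide_distrib
  proof (rule sum.cong)
    fix a
    have "\<alpha> i a j * off ?C $ i $ a = \<alpha> i a j * Y $ j $ a" "\<alpha> j a i * off ?C $ a $ j = - (\<alpha> j a i * Y $ a $ i)"
      using ij by (auto simp: \<alpha>_def off_def br)
    then have "\<alpha> i a j * (off ?C $ i $ a * Z $ a $ j) - \<alpha> j a i * (Z $ i $ a * off ?C $ a $ j)
      = \<alpha> i a j * Y $ j $ a * Z $ a $ j + \<alpha> j a i * Y $ a $ i * Z $ i $ a"
      by (simp flip: mult.assoc) (simp add: mult.commute mult.left_commute)
    then show "(\<alpha> i a j * (off ?C $ i $ a * Z $ a $ j) - \<alpha> j a i * (Z $ i $ a * off ?C $ a $ j)) / 2
      = - (\<alpha> i a j * (Y $ j $ a * Z $ j $ a) + \<alpha> j a i * (Y $ i $ a * Z $ i $ a)) / 2"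
      unfolding \<pp>_nth[OF Y, of a i] \<pp>_nth[OF Z, of a j] by simp
  qed simp
  have isotropy: "lie_bracket H Z $ i $ j
    = (\<Sum>a\<in>UNIV. - (if \<beta> a = \<beta> i \<and> a \<noteq> i then Y $ j $ a * Z $ j $ a else 0)
        - (if \<beta> a = \<beta> j \<and> a \<noteq> j then Y $ i $ a * Z $ i $ a else 0))"
    unfolding lie_bracket_nth[of _ Z]
  proof (rule sum.cong)
    fix a
    have H: "H $ i $ a = (if \<beta> a = \<beta> i \<and> a \<noteq> i then Y $ j $ a else 0)"
      "H $ a $ j = (if \<beta> a = \<beta> j \<and> a \<noteq> j then - Y $ a $ i else 0)"
      by (auto simp: H_def off_def br)
    show "H $ i $ a * Z $ a $ j - Z $ i $ a * H $ a $ j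
      = - (if \<beta> a = \<beta> i \<and> a \<noteq> i then Y $ j $ a * Z $ j $ a else 0)
        - (if \<beta> a = \<beta> j \<and> a \<noteq> j then Y $ i $ a * Z $ i $ a else 0)"
      unfolding H \<pp>_nth[OF Y, of a i] \<pp>_nth[OF Z, of a j]
      by (split if_split, intro conjI impI; split if_split, intro conjI impI; simp only: if_True if_False; simp)
  qed simp
  \<comment> \<open>Here \<open>p\<close> and \<open>q\<close> stand for the conditional isotropy
    terms, so that the summands are compared without a case split.\<close>
  have arith: "0 - (A * y + B * z) / 4 - - (C * z + E * y) / 2 - (- p - q)
      = (E / 2 - A / 4 + P) * y + (C / 2 - B / 4 + Q) * z"
    if "q = P * y" "p = Q * z" for A B C E P Q p q y z :: real
    unfolding that by (simp add: field_simps)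
  show ?thesis
    unfolding R_def H_def[symmetric] vector_minus_component \<Lambda>_wedge[OF ij] \<Lambda>\<Lambda> \<Lambda>off isotropy
    unfolding diff_0 sum_negf[symmetric] sum_subtractf[symmetric] sum.distrib[symmetric] \<kappa>_def
    by (intro sum.cong refl) (subst diff_0[symmetric], rule arith; simp)
qed

text \<open>The Ricci tensor is diagonal in the matrix entries. The two sums of
  \<open>R_wedge\<close> become equal after summation over all i and j, which cancels the factor
  1/2.\<close>

lemma ricci_eq:
  assumes Y: "Y \<in> \<pp>" and Z: "Z \<in> \<pp>"
  shows "ricci \<hh> \<pp> g Y Z = (\<Sum>i\<in>UNIV. \<Sum>a\<in>UNIV. (\<Sum>j\<in>UNIV. if \<beta> i \<noteq> \<beta> j then \<kappa> i j a else 0) * (Y $ i $ a * Z $ i $ a))"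
proof -
  define K where "K i j = (if \<beta> i \<noteq> \<beta> j then (\<Sum>a\<in>UNIV. \<kappa> i j a * (Y $ i $ a * Z $ i $ a)) else 0)" for i j
  have "(if \<beta> i \<noteq> \<beta> j then R (wedge i j) Y Z $ i $ j else 0) = K i j + K j i" for i j
    by (simp add: K_def R_wedge Y Z)
  then have "ricci \<hh> \<pp> g Y Z = ((\<Sum>i\<in>UNIV. \<Sum>j\<in>UNIV. K i j) + (\<Sum>i\<in>UNIV. \<Sum>j\<in>UNIV. K j i)) / 2"
    unfolding ricci_eq_sum_R[OF Y Z] by (simp only: sum.distrib)
  also have "(\<Sum>i\<in>UNIV. \<Sum>j\<in>UNIV. K j i) = (\<Sum>i\<in>UNIV. \<Sum>j\<in>UNIV. K i j)"
    by (rule sum.swap)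
  also have "((\<Sum>i\<in>UNIV. \<Sum>j\<in>UNIV. K i j) + (\<Sum>i\<in>UNIV. \<Sum>j\<in>UNIV. K i j)) / 2 = (\<Sum>i\<in>UNIV. \<Sum>j\<in>UNIV. K i j)"
    by simp
  also have "\<dots> = (\<Sum>i\<in>UNIV. \<Sum>a\<in>UNIV. (\<Sum>j\<in>UNIV. if \<beta> i \<noteq> \<beta> j then \<kappa> i j a else 0) * (Y $ i $ a * Z $ i $ a))"
  proof (rule sum.cong)
    fix i
    have "(\<Sum>j\<in>UNIV. K i j) = (\<Sum>j\<in>UNIV. \<Sum>a\<in>UNIV. (if \<beta> i \<noteq> \<beta> j then \<kappa> i j a else 0) * (Y $ i $ a * Z $ i $ a))"
      by (rule sum.cong) (simp_all add: K_def)
    also have "\<dots> = (\<Sum>a\<in>UNIV. \<Sum>j\<in>UNIV. (if \<beta> i \<noteq> \<beta> j then \<kappa> i j a else 0) * (Y $ i $ a * Z $ i $ a))"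
      by (rule sum.swap)
    finally show "(\<Sum>j\<in>UNIV. K i j)
      = (\<Sum>a\<in>UNIV. (\<Sum>j\<in>UNIV. if \<beta> i \<noteq> \<beta> j then \<kappa> i j a else 0) * (Y $ i $ a * Z $ i $ a))"
      by (simp only: sum_distrib_right)
  qed simp
  finally show ?thesis .
qed

definition Ric :: "'n \<Rightarrow> 'n \<Rightarrow> real" where
  "Ric i a = (\<Sum>j\<in>UNIV. if \<beta> i \<noteq> \<beta> j then \<kappa> i j a else 0)"

lemma wedge_\<pp>: "\<beta> i \<noteq> \<beta> j \<Longrightarrow> wedge i j \<in> \<pp>"
  unfolding \<pp>_def by (rule wedge_so_on) auto

lemma sum_wedge_sq:
  fixes f :: "'n \<Rightarrow> 'n \<Rightarrow> real"
  assumes "i \<noteq> j"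
  shows "(\<Sum>p\<in>UNIV. \<Sum>q\<in>UNIV. f p q * (wedge i j $ p $ q * wedge i j $ p $ q)) = f i j + f j i"
proof -
  have "f p q * (wedge i j $ p $ q * wedge i j $ p $ q)
      = (if p = i \<and> q = j then f p q else 0) + (if p = j \<and> q = i then f p q else 0)" for p q
    using assms by (auto simp: wedge_nth)
  then show ?thesis
    by (simp only: sum.distrib sum2_delta)
qed

text \<open>\<open>Ric\<close> itself need not be symmetric, but Y_ia Z_ia is symmetric in i and a,
  so only \<open>Ric i a + Ric a i\<close> matters. Testing on \<open>wedge i a\<close> shows
  necessity.\<close>

lemma einstein_iff:
  "einstein \<hh> \<pp> g \<longleftrightarrow> (\<exists>c. \<forall>i a. \<beta> i \<noteq> \<beta> a \<longrightarrow> Ric i a + Ric a i = 2 * c * \<nu> * w i a)"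
proof
  assume "einstein \<hh> \<pp> g"
  then obtain c where c: "\<And>X Y. X \<in> \<pp> \<Longrightarrow> Y \<in> \<pp> \<Longrightarrow> ricci \<hh> \<pp> g X Y = c * g X Y"
    unfolding einstein_def by blast
  have "Ric i a + Ric a i = 2 * c * \<nu> * w i a" if ia: "\<beta> i \<noteq> \<beta> a" for i a
  proof -
    have "i \<noteq> a" using ia by auto
    note [simp] = sum_wedge_sq[OF this]
    have "ricci \<hh> \<pp> g (wedge i a) (wedge i a) = Ric i a + Ric a i"
      unfolding ricci_eq[OF wedge_\<pp>[OF ia] wedge_\<pp>[OF ia]] Ric_def[symmetric] by simp
    moreover have "g (wedge i a) (wedge i a) = \<nu> * (w i a + w a i)"
      unfolding g_eq[OF wedge_\<pp>[OF ia] wedge_\<pp>[OF ia]] by simp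
    ultimately show ?thesis
      using c[OF wedge_\<pp>[OF ia] wedge_\<pp>[OF ia]] w_sym[of a i] by simp
  qed
  then show "\<exists>c. \<forall>i a. \<beta> i \<noteq> \<beta> a \<longrightarrow> Ric i a + Ric a i = 2 * c * \<nu> * w i a"
    by blast
next
  assume "\<exists>c. \<forall>i a. \<beta> i \<noteq> \<beta> a \<longrightarrow> Ric i a + Ric a i = 2 * c * \<nu> * w i a"
  then obtain c where c: "\<And>i a. \<beta> i \<noteq> \<beta> a \<Longrightarrow> Ric i a + Ric a i = 2 * c * \<nu> * w i a"
    by blast
  have "ricci \<hh> \<pp> g X Y = c * g X Y" if X: "X \<in> \<pp>" and Y: "Y \<in> \<pp>" for X Y
  proof -
    let ?XY = "\<lambda>i a. X $ i $ a * Y $ i $ a"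
    have "2 * ricci \<hh> \<pp> g X Y = (\<Sum>i\<in>UNIV. \<Sum>a\<in>UNIV. Ric i a * ?XY i a) + (\<Sum>i\<in>UNIV. \<Sum>a\<in>UNIV. Ric i a * ?XY i a)"
      unfolding ricci_eq[OF X Y] Ric_def[symmetric] by simp
    also have "\<dots> = (\<Sum>i\<in>UNIV. \<Sum>a\<in>UNIV. Ric i a * ?XY i a) + (\<Sum>i\<in>UNIV. \<Sum>a\<in>UNIV. Ric a i * ?XY a i)"
      by (rule arg_cong[OF sum.swap])
    also have "\<dots> = (\<Sum>i\<in>UNIV. \<Sum>a\<in>UNIV. Ric i a * ?XY i a + Ric a i * ?XY a i)"
      by (simp only: sum.distrib)
    also have "\<dots> = (\<Sum>i\<in>UNIV. \<Sum>a\<in>UNIV. 2 * c * \<nu> * (w i a * ?XY i a))"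
    proof (intro sum.cong refl)
      fix i a
      have swap: "?XY a i = ?XY i a"
        using \<pp>_nth[OF X, of a i] \<pp>_nth[OF Y, of a i] by simp
      show "Ric i a * ?XY i a + Ric a i * ?XY a i = 2 * c * \<nu> * (w i a * ?XY i a)"
      proof (cases "\<beta> i = \<beta> a")
        case True
        then have "?XY i a = 0"
          using \<pp>_zero[OF X, of i a] by simp
        then show ?thesis
          unfolding swap by (simp only: mult_zero_right add_0)
      next
        case False
        then show ?thesis
          unfolding swap distrib_right[symmetric] c[OF False] by (simp only: mult.assoc)
      qed
    qed
    also have "\<dots> = 2 * (c * g X Y)"
      unfolding g_eq[OF X Y] by (simp add: mult.assoc flip: sum_distrib_left)
    finally show ?thesis by simp
  qed
  then show "einstein \<hh> \<pp> g"
    unfolding einstein_def by blast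
qed

end

section \<open>Isotropy complement and metric for three blocks\<close>

lemma sum_UNIV_Plus:
  fixes f :: "'a::finite + 'b::finite \<Rightarrow> real"
  shows "(\<Sum>j\<in>UNIV. f j) = (\<Sum>j\<in>UNIV. f (Inl j)) + (\<Sum>j\<in>UNIV. f (Inr j))"
  by (simp add: sum.Plus flip: UNIV_Plus_UNIV)

text \<open>Blocks 2, 3 have label sum 5 and blocks 1, 3 have sum 4, so the parameter is read off
  from a symmetric expression. Pairs inside a block receive some parameter as a positive default;
  the entries of \<open>\<pp>\<close> vanish there.\<close>

definition weight :: "real \<times> real \<times> real \<Rightarrow> 'k + ('l + 'm) \<Rightarrow> 'k + ('l + 'm) \<Rightarrow> real" where
  "weight = (\<lambda>(x1, x2, x3) i j.
     if block i + block j = 5 then x1 else if block i + block j = 4 then x2 else x3)"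

lemma inner_prod_eq:
  fixes X Y :: "('k::finite, 'l::finite, 'm::finite) block_matrix"
  assumes "X \<in> so" "Y \<in> so"
  shows "inner_prod X Y = (real (CARD('k) + CARD('l) + CARD('m)) - 2) * (\<Sum>i\<in>UNIV. \<Sum>j\<in>UNIV. X $ i $ j * Y $ i $ j)"
  unfolding inner_prod_def killing_form_so[OF assms] by (simp add: algebra_simps)

lemma isotropy_eq: "isotropy = so_on (\<lambda>i j. \<not> (block i \<noteq> block j))"
  by (simp add: isotropy_def so_on_def)

text \<open>For more than two indices the Killing form of \<open>so\<close> is a nonzero multiple of
  the trace form; orthogonality to \<open>wedge i j\<close> inside a block then says that A_ij -
  A_ji = 0.\<close>

lemma isotropy_compl_eq:
  assumes "CARD('k) + CARD('l) + CARD('m) > 2"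
  shows "(isotropy_compl :: ('k::finite, 'l::finite, 'm::finite) block_matrix set)
    = so_on (\<lambda>i j. block i \<noteq> block j)"
proof (intro set_eqI iffI)
  fix A :: "('k, 'l, 'm) block_matrix"
  assume "A \<in> isotropy_compl"
  then have A: "A \<in> so" and orth: "\<And>C. C \<in> isotropy \<Longrightarrow> inner_prod A C = 0"
    unfolding isotropy_compl_def by blast+
  have "A $ i $ j = 0" if ij: "block i = block j" for i j
  proof (cases "i = j")
    case True
    then show ?thesis using so_diag[OF A] by simp
  next
    case False
    note W = wedge_so[of i j]
    have "wedge i j \<in> isotropy"
      unfolding isotropy_eq using ij by (intro wedge_so_on) simp_all
    then have "inner_prod A (wedge i j) = 0"
      by (rule orth)
    moreover have "real (CARD('k) + CARD('l) + CARD('m)) - 2 \<noteq> 0"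
      using assms by linarith
    ultimately have "(\<Sum>p\<in>UNIV. \<Sum>q\<in>UNIV. A $ p $ q * wedge i j $ p $ q) = 0"
      unfolding inner_prod_eq[OF A W] mult_eq_0_iff by blast
    moreover have "A $ p $ q * wedge i j $ p $ q
        = (if p = i \<and> q = j then A $ p $ q else 0) - (if p = j \<and> q = i then A $ p $ q else 0)" for p q
      using False by (auto simp: wedge_nth)
    ultimately have "A $ i $ j - A $ j $ i = 0"
      by (simp only: sum_subtractf sum2_delta)
    then show ?thesis
      using so_nth[OF A, of j i] by simp
  qed
  then show "A \<in> so_on (\<lambda>i j. block i \<noteq> block j)"
    using A by (simp add: so_on_def)
next
  fix A :: "('k, 'l, 'm) block_matrix"
  assume A: "A \<in> so_on (\<lambda>i j. block i \<noteq> block j)"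
  have "inner_prod A C = 0" if C: "C \<in> isotropy" for C
  proof -
    have so: "A \<in> so" "C \<in> so"
      using A C by (auto simp: so_on_def isotropy_def)
    have prod: "A $ i $ j * C $ i $ j = 0" for i j
      using A C unfolding so_on_def isotropy_def by (metis (mono_tags, lifting) mem_Collect_eq mult_eq_0_iff)
    show ?thesis
      unfolding inner_prod_eq[OF so] prod by simp
  qed
  moreover have "A \<in> so"
    using A by (simp add: so_on_def)
  ultimately show "A \<in> isotropy_compl"
    unfolding isotropy_compl_def by blast
qed

lemma metric_eq:
  fixes X Y :: "('k::finite, 'l::finite, 'm::finite) block_matrix"
  assumes X: "X \<in> so_on (\<lambda>i j. block i \<noteq> block j)" and Y: "Y \<in> so_on (\<lambda>i j. block i \<noteq> block j)"
  shows "metric x X Y = (real (CARD('k) + CARD('l) + CARD('m)) - 2)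
    * (\<Sum>i\<in>UNIV. \<Sum>j\<in>UNIV. weight x i j * (X $ i $ j * Y $ i $ j))"
proof -
  obtain x1 x2 x3 where x: "x = (x1, x2, x3)"
    by (cases x)
  let ?n = "real (CARD('k) + CARD('l) + CARD('m)) - 2"
  have part_so: "part s A \<in> so" if "A \<in> so_on (\<lambda>i j. block i \<noteq> block j)" for s and A :: "('k, 'l, 'm) block_matrix"
  proof -
    have "A \<in> so"
      using that by (simp add: so_on_def)
    then have "part s A $ j $ i = - part s A $ i $ j" for i j
      using so_nth[of A j i] by (simp add: part_def insert_commute)
    then show ?thesis unfolding mem_so by blast
  qed
  have "metric x X Y = ?n * (\<Sum>i\<in>UNIV. \<Sum>j\<in>UNIV. x1 * (part 1 X $ i $ j * part 1 Y $ i $ j)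
    + x2 * (part 2 X $ i $ j * part 2 Y $ i $ j) + x3 * (part 3 X $ i $ j * part 3 Y $ i $ j))"
    unfolding metric_def x prod.case inner_prod_eq[OF part_so[OF X] part_so[OF Y]] sum.distrib
    by (simp add: distrib_left mult.left_commute flip: sum_distrib_left)
  also have "\<dots> = ?n * (\<Sum>i\<in>UNIV. \<Sum>j\<in>UNIV. weight x i j * (X $ i $ j * Y $ i $ j))"
  proof (intro arg_cong[where f="\<lambda>t. ?n * t"] sum.cong refl)
    fix i j
    have diff: "{1, 2, 3::nat} - {1} = {2, 3}" "{1, 2, 3::nat} - {2} = {1, 3}" "{1, 2, 3::nat} - {3} = {1, 2}"
      by auto
    have zero: "block i = block j \<Longrightarrow> X $ i $ j = 0"
      using X by (simp add: so_on_def)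
    show "x1 * (part 1 X $ i $ j * part 1 Y $ i $ j) + x2 * (part 2 X $ i $ j * part 2 Y $ i $ j)
        + x3 * (part 3 X $ i $ j * part 3 Y $ i $ j) = weight x i j * (X $ i $ j * Y $ i $ j)"
      unfolding part_def diff vec_lambda_beta weight_def x prod.case
      using zero by (cases i rule: block.cases; cases j rule: block.cases) (simp_all add: doubleton_eq_iff)
  qed
  finally show ?thesis .
qed

section \<open>The Einstein equations for three blocks\<close>
lemma weight_pos: "x1 > 0 \<Longrightarrow> x2 > 0 \<Longrightarrow> x3 > 0 \<Longrightarrow> weight (x1, x2, x3) i j > 0"
  by (simp add: weight_def)

lemma sum_ne: "(\<Sum>j\<in>(UNIV :: 'a::finite set). if q \<noteq> j then 1 else 0 :: real) = real CARD('a) - 1"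
proof -
  have "(\<Sum>j\<in>(UNIV :: 'a set). if q \<noteq> j then 1 else 0 :: real) = (\<Sum>j\<in>UNIV. 1 - (if j = q then 1 else 0))"
    by (intro sum.cong) auto
  then show ?thesis
    by (simp add: sum_subtractf)
qed

text \<open>Value of \<open>\<kappa> i j a\<close> for i, j, a in three different blocks, where A,
  B, C are the weights of the pairs (i,a), (i,j), (j,a).\<close>

definition ric_coeff :: "real \<Rightarrow> real \<Rightarrow> real \<Rightarrow> real" where
  "ric_coeff A B C = (B + A - C) / B / 2 - (B + C - A) / B * ((C + A - B) / C) / 4"

lemma ric_coeff_sym:
  "A > 0 \<Longrightarrow> B > 0 \<Longrightarrow> C > 0 \<Longrightarrow> ric_coeff A B C + ric_coeff A C B = 1 + (A\<^sup>2 - B\<^sup>2 - C\<^sup>2) / (2 * B * C)"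
  by (simp add: ric_coeff_def field_simps power2_eq_square)

text \<open>The left-hand sides are 2 (n - 2) x_i r_i, where r_i is the Ricci eigenvalue on the i-th
  summand, so c stands for the common value of 2 (n - 2) r_i.\<close>

lemma einstein_metric_iff:
  fixes x1 x2 x3 :: real
  assumes pos: "x1 > 0" "x2 > 0" "x3 > 0" and card: "CARD('k) + CARD('l) + CARD('m) > 2"
  defines "k \<equiv> real CARD('k::finite)" and "l \<equiv> real CARD('l::finite)" and "m \<equiv> real CARD('m::finite)"
  shows "einstein (isotropy :: ('k, 'l, 'm) block_matrix set) isotropy_compl (metric (x1, x2, x3)) \<longleftrightarrow>
    (\<exists>c. k + l + m - 2 + k * (x1\<^sup>2 - x2\<^sup>2 - x3\<^sup>2) / (2 * x2 * x3) = c * x1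
      \<and> k + l + m - 2 + l * (x2\<^sup>2 - x1\<^sup>2 - x3\<^sup>2) / (2 * x1 * x3) = c * x2
      \<and> k + l + m - 2 + m * (x3\<^sup>2 - x1\<^sup>2 - x2\<^sup>2) / (2 * x1 * x2) = c * x3)"
proof -
  define \<nu> where "\<nu> = k + l + m - 2"
  have \<nu>: "\<nu> > 0" "real (CARD('k) + CARD('l) + CARD('m)) - 2 = \<nu>"
    using card by (simp_all add: \<nu>_def k_def l_def m_def)
  let ?w = "weight (x1, x2, x3) :: 'k + ('l + 'm) \<Rightarrow> _"
  interpret block_metric "block :: 'k + ('l + 'm) \<Rightarrow> nat" ?w \<nu> "metric (x1, x2, x3)" isotropy isotropy_compl
  proof
    show "?w i j = ?w j i" for i j
      by (simp add: weight_def add.commute)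
    show "?w i j > 0" for i j
      by (rule weight_pos[OF pos])
    show "\<nu> > 0"
      by (rule \<nu>)
    show compl: "(isotropy_compl :: ('k, 'l, 'm) block_matrix set) = so_on (\<lambda>i j. block i \<noteq> block j)"
      by (rule isotropy_compl_eq[OF card])
    show "(isotropy :: ('k, 'l, 'm) block_matrix set) = so_on (\<lambda>i j. \<not> (block i \<noteq> block j))"
      by (rule isotropy_eq)
    show "metric (x1, x2, x3) X Y = \<nu> * (\<Sum>i\<in>UNIV. \<Sum>j\<in>UNIV. ?w i j * (X $ i $ j * Y $ i $ j))"
      if "X \<in> isotropy_compl" "Y \<in> isotropy_compl" for X Y
      using that unfolding compl by (simp only: metric_eq \<nu>(2))
  qed
  have w [simp]: "?w (Inl p) (Inr (Inl q)) = x3" "?w (Inr (Inl q)) (Inl p) = x3"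
    "?w (Inl p) (Inr (Inr r)) = x2" "?w (Inr (Inr r)) (Inl p) = x2"
    "?w (Inr (Inl q)) (Inr (Inr r)) = x1" "?w (Inr (Inr r)) (Inr (Inl q)) = x1" for p q r
    by (simp_all add: weight_def)
  note Ric_simps = Ric_def sum_UNIV_Plus \<kappa>_def \<alpha>_def ric_coeff_def sum_ne k_def l_def m_def
  have Ric: "Ric (Inl p) (Inr (Inl q)) = l - 1 + m * ric_coeff x3 x2 x1"
    "Ric (Inr (Inl q)) (Inl p) = k - 1 + m * ric_coeff x3 x1 x2"
    "Ric (Inl p) (Inr (Inr r)) = m - 1 + l * ric_coeff x2 x3 x1"
    "Ric (Inr (Inr r)) (Inl p) = k - 1 + l * ric_coeff x2 x1 x3"
    "Ric (Inr (Inl q)) (Inr (Inr r)) = m - 1 + k * ric_coeff x1 x3 x2"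
    "Ric (Inr (Inr r)) (Inr (Inl q)) = l - 1 + k * ric_coeff x1 x2 x3" for p q r
    by (simp_all add: Ric_simps)
  have sum: "l - 1 + m * ric_coeff x3 x2 x1 + (k - 1 + m * ric_coeff x3 x1 x2)
      = \<nu> + m * (x3\<^sup>2 - x1\<^sup>2 - x2\<^sup>2) / (2 * x1 * x2)"
    "m - 1 + l * ric_coeff x2 x3 x1 + (k - 1 + l * ric_coeff x2 x1 x3)
      = \<nu> + l * (x2\<^sup>2 - x1\<^sup>2 - x3\<^sup>2) / (2 * x1 * x3)"
    "m - 1 + k * ric_coeff x1 x3 x2 + (l - 1 + k * ric_coeff x1 x2 x3)
      = \<nu> + k * (x1\<^sup>2 - x2\<^sup>2 - x3\<^sup>2) / (2 * x2 * x3)"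
  proof -
    have "m * ric_coeff x3 x1 x2 + m * ric_coeff x3 x2 x1 = m * (1 + (x3\<^sup>2 - x1\<^sup>2 - x2\<^sup>2) / (2 * x1 * x2))"
      "l * ric_coeff x2 x1 x3 + l * ric_coeff x2 x3 x1 = l * (1 + (x2\<^sup>2 - x1\<^sup>2 - x3\<^sup>2) / (2 * x1 * x3))"
      "k * ric_coeff x1 x2 x3 + k * ric_coeff x1 x3 x2 = k * (1 + (x1\<^sup>2 - x2\<^sup>2 - x3\<^sup>2) / (2 * x2 * x3))"
      unfolding distrib_left[symmetric] using pos by (simp_all only: ric_coeff_sym)
    then show
      "l - 1 + m * ric_coeff x3 x2 x1 + (k - 1 + m * ric_coeff x3 x1 x2)
        = \<nu> + m * (x3\<^sup>2 - x1\<^sup>2 - x2\<^sup>2) / (2 * x1 * x2)"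
      "m - 1 + l * ric_coeff x2 x3 x1 + (k - 1 + l * ric_coeff x2 x1 x3)
        = \<nu> + l * (x2\<^sup>2 - x1\<^sup>2 - x3\<^sup>2) / (2 * x1 * x3)"
      "m - 1 + k * ric_coeff x1 x3 x2 + (l - 1 + k * ric_coeff x1 x2 x3)
        = \<nu> + k * (x1\<^sup>2 - x2\<^sup>2 - x3\<^sup>2) / (2 * x2 * x3)"
      unfolding \<nu>_def distrib_left times_divide_eq_right[symmetric] mult_1_right by linarith+
  qed
  note sum' = trans[OF add.commute sum(1)] trans[OF add.commute sum(2)] trans[OF add.commute sum(3)]
  have Ric_add:
    "Ric (Inl p) (Inr (Inl q)) + Ric (Inr (Inl q)) (Inl p) = \<nu> + m * (x3\<^sup>2 - x1\<^sup>2 - x2\<^sup>2) / (2 * x1 * x2)"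
    "Ric (Inr (Inl q)) (Inl p) + Ric (Inl p) (Inr (Inl q)) = \<nu> + m * (x3\<^sup>2 - x1\<^sup>2 - x2\<^sup>2) / (2 * x1 * x2)"
    "Ric (Inl p) (Inr (Inr r)) + Ric (Inr (Inr r)) (Inl p) = \<nu> + l * (x2\<^sup>2 - x1\<^sup>2 - x3\<^sup>2) / (2 * x1 * x3)"
    "Ric (Inr (Inr r)) (Inl p) + Ric (Inl p) (Inr (Inr r)) = \<nu> + l * (x2\<^sup>2 - x1\<^sup>2 - x3\<^sup>2) / (2 * x1 * x3)"
    "Ric (Inr (Inl q)) (Inr (Inr r)) + Ric (Inr (Inr r)) (Inr (Inl q)) = \<nu> + k * (x1\<^sup>2 - x2\<^sup>2 - x3\<^sup>2) / (2 * x2 * x3)"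
    "Ric (Inr (Inr r)) (Inr (Inl q)) + Ric (Inr (Inl q)) (Inr (Inr r)) = \<nu> + k * (x1\<^sup>2 - x2\<^sup>2 - x3\<^sup>2) / (2 * x2 * x3)"
    for p q r
    by (simp_all only: Ric sum sum')
  have swap: "(\<forall>i a :: 'k + ('l + 'm). block i \<noteq> block a \<longrightarrow> Ric i a + Ric a i = 2 * c * \<nu> * ?w i a)
    \<longleftrightarrow> \<nu> + k * (x1\<^sup>2 - x2\<^sup>2 - x3\<^sup>2) / (2 * x2 * x3) = 2 * c * \<nu> * x1
      \<and> \<nu> + l * (x2\<^sup>2 - x1\<^sup>2 - x3\<^sup>2) / (2 * x1 * x3) = 2 * c * \<nu> * x2
      \<and> \<nu> + m * (x3\<^sup>2 - x1\<^sup>2 - x2\<^sup>2) / (2 * x1 * x2) = 2 * c * \<nu> * x3" for c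
    by (simp add: split_sum_all Ric_add conj_commute conj_left_commute)
  show ?thesis
    unfolding einstein_iff swap \<nu>_def[symmetric]
  proof (rule iffI; elim exE)
    fix c
    assume "\<nu> + k * (x1\<^sup>2 - x2\<^sup>2 - x3\<^sup>2) / (2 * x2 * x3) = c * x1
      \<and> \<nu> + l * (x2\<^sup>2 - x1\<^sup>2 - x3\<^sup>2) / (2 * x1 * x3) = c * x2
      \<and> \<nu> + m * (x3\<^sup>2 - x1\<^sup>2 - x2\<^sup>2) / (2 * x1 * x2) = c * x3"
    moreover have c: "2 * (c / (2 * \<nu>)) * \<nu> = c"
      using \<nu>(1) by simp
    ultimately show "\<exists>c. \<nu> + k * (x1\<^sup>2 - x2\<^sup>2 - x3\<^sup>2) / (2 * x2 * x3) = 2 * c * \<nu> * x1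
      \<and> \<nu> + l * (x2\<^sup>2 - x1\<^sup>2 - x3\<^sup>2) / (2 * x1 * x3) = 2 * c * \<nu> * x2
      \<and> \<nu> + m * (x3\<^sup>2 - x1\<^sup>2 - x2\<^sup>2) / (2 * x1 * x2) = 2 * c * \<nu> * x3"
      by (intro exI[of _ "c / (2 * \<nu>)"]) (simp only: c)
  qed (rule exI)
qed

text \<open>The three expressions are 4 (n - 2) x y z r_i: the equations r_1 = r_2 = r_3 without
  denominators, as homogeneous quadratic equations.\<close>

definition ricci_balanced :: "real \<Rightarrow> real \<Rightarrow> real \<Rightarrow> real \<Rightarrow> real \<Rightarrow> real \<Rightarrow> bool" where
  "ricci_balanced k l m x y z \<longleftrightarrow>
     2 * (k + l + m - 2) * y * z + k * (x\<^sup>2 - y\<^sup>2 - z\<^sup>2) = 2 * (k + l + m - 2) * x * z + l * (y\<^sup>2 - x\<^sup>2 - z\<^sup>2)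
   \<and> 2 * (k + l + m - 2) * x * z + l * (y\<^sup>2 - x\<^sup>2 - z\<^sup>2) = 2 * (k + l + m - 2) * x * y + m * (z\<^sup>2 - x\<^sup>2 - y\<^sup>2)"

lemma einstein_metrics_eq:
  assumes card: "CARD('k) + CARD('l) + CARD('m) > 2"
  shows "einstein_metrics TYPE('k::finite) TYPE('l::finite) TYPE('m::finite) =
    {(x, y, z). x > 0 \<and> y > 0 \<and> z > 0 \<and> ricci_balanced (real CARD('k)) (real CARD('l)) (real CARD('m)) x y z}"
proof -
  have "(\<exists>c. n + k * (x\<^sup>2 - y\<^sup>2 - z\<^sup>2) / (2 * y * z) = c * x
      \<and> n + l * (y\<^sup>2 - x\<^sup>2 - z\<^sup>2) / (2 * x * z) = c * y
      \<and> n + m * (z\<^sup>2 - x\<^sup>2 - y\<^sup>2) / (2 * x * y) = c * z)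
    \<longleftrightarrow> 2 * n * y * z + k * (x\<^sup>2 - y\<^sup>2 - z\<^sup>2) = 2 * n * x * z + l * (y\<^sup>2 - x\<^sup>2 - z\<^sup>2)
      \<and> 2 * n * x * z + l * (y\<^sup>2 - x\<^sup>2 - z\<^sup>2) = 2 * n * x * y + m * (z\<^sup>2 - x\<^sup>2 - y\<^sup>2)"
    if "x > 0" "y > 0" "z > 0" for k l m n x y z :: real
  proof -
    have eq: "n + a * F / (2 * u * v) = c * t \<longleftrightarrow> 2 * n * u * v + a * F = 2 * c * (t * (u * v))"
      if "u > 0" "v > 0" for a F u v c t :: real
      using that by (simp add: field_simps)
    \<comment> \<open>As x y z is positive, every real number is 2 c x y z for some c, so the
      existential statement only asks the three expressions to agree.\<close>
    have "\<exists>c. P = 2 * c * (x * (y * z))" for P :: real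
      using that by (intro exI[of _ "P / (2 * (x * (y * z)))"]) simp
    moreover have "y * (x * z) = x * (y * z)" "z * (x * y) = x * (y * z)"
      by simp_all
    ultimately show ?thesis
      using that by (simp only: eq) metis
  qed
  then show ?thesis
    unfolding einstein_metrics_def ricci_balanced_def
    by (auto simp: einstein_metric_iff[OF _ _ _ card])
qed

section \<open>Counting solutions: two equal block sizes\<close>
definition balanced_pairs :: "real \<Rightarrow> real \<Rightarrow> real \<Rightarrow> (real \<times> real) set" where
  "balanced_pairs k l m = {(x, y). x > 0 \<and> y > 0 \<and> ricci_balanced k l m x y 1}"

lemma ricci_balanced_scale:
  assumes "c \<noteq> 0"
  shows "ricci_balanced k l m (c * x) (c * y) (c * z) \<longleftrightarrow> ricci_balanced k l m x y z"
proof -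
  have scale: "2 * n * (c * u) * (c * v) + a * ((c * t)\<^sup>2 - (c * u)\<^sup>2 - (c * v)\<^sup>2)
      = c\<^sup>2 * (2 * n * u * v + a * (t\<^sup>2 - u\<^sup>2 - v\<^sup>2))" for n a t u v :: real
    by (simp add: algebra_simps power2_eq_square)
  show ?thesis
    unfolding ricci_balanced_def scale using assms by simp
qed

lemma homothety_Image:
  "homothety `` {(x, y, z)} = {(c * x, c * y, c * z) | c. c > 0}"
  by (auto simp: homothety_def)

text \<open>Every ray in the positive octant meets the plane z = 1 in exactly one point.\<close>

lemma card_quotient_homothety:
  "card ({(x, y, z). x > 0 \<and> y > 0 \<and> z > 0 \<and> ricci_balanced k l m x y z} // homothety)
    = card (balanced_pairs k l m)"
proof -
  let ?E = "{(x, y, z). x > 0 \<and> y > 0 \<and> z > 0 \<and> ricci_balanced k l m x y z}"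
  let ?f = "\<lambda>(x, y). homothety `` {(x, y, 1)}"
  have "?E // homothety = ?f ` balanced_pairs k l m"
  proof (intro equalityI subsetI)
    fix C assume "C \<in> ?E // homothety"
    then obtain x y z where pos: "x > 0" "y > 0" "z > 0" and bal: "ricci_balanced k l m x y z"
      and C: "C = homothety `` {(x, y, z)}"
      by (auto elim!: quotientE)
    have "ricci_balanced k l m (z * (x / z)) (z * (y / z)) (z * 1)"
      using bal pos by simp
    then have "(x / z, y / z) \<in> balanced_pairs k l m"
      unfolding balanced_pairs_def using pos ricci_balanced_scale[of z k l m "x / z" "y / z" 1] by simp
    moreover have "C = homothety `` {(x / z, y / z, 1)}"
    proof -
      have "{(c * x, c * y, c * z) | c. c > 0} = {(c * (x / z), c * (y / z), c * 1) | c. c > 0}"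
      proof (intro equalityI subsetI)
        fix t assume "t \<in> {(c * x, c * y, c * z) | c. c > 0}"
        then obtain c where "c > 0" "t = (c * x, c * y, c * z)" by blast
        then have "c * z > 0" "t = ((c * z) * (x / z), (c * z) * (y / z), (c * z) * 1)"
          using pos by simp_all
        then show "t \<in> {(c * (x / z), c * (y / z), c * 1) | c. c > 0}" by blast
      next
        fix t assume "t \<in> {(c * (x / z), c * (y / z), c * 1) | c. c > 0}"
        then obtain c where "c > 0" "t = (c * (x / z), c * (y / z), c * 1)" by blast
        then have "c / z > 0" "t = ((c / z) * x, (c / z) * y, (c / z) * z)"
          using pos by simp_all
        then show "t \<in> {(c * x, c * y, c * z) | c. c > 0}" by blast
      qed
      then show ?thesis
        by (simp only: C homothety_Image)
    qed
    ultimately show "C \<in> ?f ` balanced_pairs k l m"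
      by (intro image_eqI[of _ _ "(x / z, y / z)"]) simp_all
  next
    fix C assume "C \<in> ?f ` balanced_pairs k l m"
    then obtain x y where "(x, y) \<in> balanced_pairs k l m" and C: "C = homothety `` {(x, y, 1)}"
      by auto
    then have "(x, y, 1) \<in> ?E"
      by (simp add: balanced_pairs_def)
    then show "C \<in> ?E // homothety"
      unfolding C by (rule quotientI)
  qed
  moreover have "inj_on ?f (balanced_pairs k l m)"
  proof (rule inj_onI)
    fix p q assume eq: "?f p = ?f q"
    obtain x y x' y' where pq: "p = (x, y)" "q = (x', y')"
      by (cases p, cases q)
    have "(1 * x, 1 * y, 1 * 1) \<in> homothety `` {(x, y, 1)}"
      unfolding homothety_Image using zero_less_one by blast
    then have "(1 * x, 1 * y, 1 * 1) \<in> homothety `` {(x', y', 1)}"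
      using eq by (simp only: pq prod.case)
    then obtain c where "(1 * x, 1 * y, 1 * 1) = (c * x', c * y', c * 1)"
      unfolding homothety_Image by blast
    then show "p = q"
      by (simp add: pq)
  qed
  ultimately show ?thesis
    by (simp add: card_image)
qed

section \<open>Quadratic equations on and off the diagonal x = y\<close>

lemma quadratic_roots:
  fixes A B C :: real
  assumes "A > 0" "B > 0" "C > 0" and disc: "B\<^sup>2 > 4 * A * C"
  obtains r1 r2 where "0 < r1" "r1 < r2" "\<And>t. A * t\<^sup>2 - B * t + C = 0 \<longleftrightarrow> t = r1 \<or> t = r2"
proof -
  define D where "D = sqrt (B\<^sup>2 - 4 * A * C)"
  have D: "D > 0" "D\<^sup>2 = B\<^sup>2 - 4 * A * C"
    using disc by (simp_all add: D_def)
  have "D\<^sup>2 < B\<^sup>2"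
    using assms D by simp
  then have "D < B"
    using \<open>B > 0\<close> by (meson less_imp_le power_less_imp_less_base)
  have "A * t\<^sup>2 - B * t + C = 0 \<longleftrightarrow> t = (B - D) / (2 * A) \<or> t = (B + D) / (2 * A)" for t
  proof -
    have "4 * A * (A * t\<^sup>2 - B * t + C) = (2 * A * t - B)\<^sup>2 - D\<^sup>2"
      unfolding D(2) by (simp add: power2_eq_square algebra_simps)
    also have "\<dots> = (2 * A * t - (B - D)) * (2 * A * t - (B + D))"
      by (simp add: power2_eq_square algebra_simps)
    finally have "A * t\<^sup>2 - B * t + C = 0 \<longleftrightarrow> 2 * A * t = B - D \<or> 2 * A * t = B + D"
      using \<open>A > 0\<close> by (metis eq_iff_diff_eq_0 mult_eq_0_iff order_less_irrefl zero_neq_numeral)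
    then show ?thesis
      using \<open>A > 0\<close> by (simp add: field_simps)
  qed
  then show thesis
    using that[of "(B - D) / (2 * A)" "(B + D) / (2 * A)"] \<open>A > 0\<close> D(1) \<open>D < B\<close>
    by (simp add: divide_strict_right_mono)
qed

lemma quadratic_no_root:
  fixes A B C :: real
  assumes "A > 0" "B\<^sup>2 < 4 * A * C"
  shows "A * t\<^sup>2 - B * t + C \<noteq> 0"
proof
  assume "A * t\<^sup>2 - B * t + C = 0"
  then have "0 = 4 * A * (A * t\<^sup>2 - B * t + C)" by simp
  also have "\<dots> = (2 * A * t - B)\<^sup>2 + (4 * A * C - B\<^sup>2)"
    by (simp add: power2_eq_square algebra_simps)
  finally show False
    using assms zero_le_power2[of "2 * A * t - B"] by linarith
qed

text \<open>For equal sizes, exchanging x and y exchanges E1 and E2, so E1 - E2 has the factor x -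
  y. The companion E1 + E2 - 2 E3 is chosen symmetric in x and y.\<close>

lemma ricci_balanced_eq_iff:
  "ricci_balanced a a b x y 1 \<longleftrightarrow> (x - y) * (a * (x + y) - (2 * a + b - 2)) = 0
     \<and> (2 * a + b - 2) * (x + y - 2 * x * y) - a - b * (1 - x\<^sup>2 - y\<^sup>2) = 0"
proof -
  define E1 E2 E3 where "E1 = 2 * (a + a + b - 2) * y * 1 + a * (x\<^sup>2 - y\<^sup>2 - 1\<^sup>2)"
    and "E2 = 2 * (a + a + b - 2) * x * 1 + a * (y\<^sup>2 - x\<^sup>2 - 1\<^sup>2)"
    and "E3 = 2 * (a + a + b - 2) * x * y + b * (1\<^sup>2 - x\<^sup>2 - y\<^sup>2)"
  have "E1 - E2 = 2 * ((x - y) * (a * (x + y) - (2 * a + b - 2)))"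
    "E1 + E2 - 2 * E3 = 2 * ((2 * a + b - 2) * (x + y - 2 * x * y) - a - b * (1 - x\<^sup>2 - y\<^sup>2))"
    by (simp_all add: E1_def E2_def E3_def power2_eq_square algebra_simps)
  moreover have "ricci_balanced a a b x y 1 \<longleftrightarrow> E1 = E2 \<and> E2 = E3"
    by (simp add: ricci_balanced_def E1_def E2_def E3_def)
  moreover have "E1 = E2 \<and> E2 = E3 \<longleftrightarrow> E1 - E2 = 0 \<and> E1 + E2 - 2 * E3 = 0"
    by auto
  ultimately have "ricci_balanced a a b x y 1 \<longleftrightarrow> 2 * ((x - y) * (a * (x + y) - (2 * a + b - 2))) = 0
      \<and> 2 * ((2 * a + b - 2) * (x + y - 2 * x * y) - a - b * (1 - x\<^sup>2 - y\<^sup>2)) = 0"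
    by (simp only:)
  moreover have "2 * P = 0 \<longleftrightarrow> P = 0" for P :: real
    by simp
  ultimately show ?thesis
    by (simp only:)
qed

text \<open>Off the diagonal the linear factor fixes the sum x + y, and the second equation, being
  symmetric, then fixes the product.\<close>

lemma balanced_pairs_eq_iff:
  fixes a b :: real
  assumes a: "a \<ge> 2" and b: "b \<ge> 1"
  defines "\<sigma> \<equiv> (2 * a + b - 2) / a"
  defines "\<pi> \<equiv> (a + b) * (\<sigma>\<^sup>2 - 1) / (4 * (a + b - 1))"
  shows "(x, y) \<in> balanced_pairs a a b \<longleftrightarrow> x > 0 \<and> y > 0 \<and>
     (x = y \<and> (4 * a - 4) * x\<^sup>2 - (4 * a + 2 * b - 4) * x + (a + b) = 0 \<or> x \<noteq> y \<and> x + y = \<sigma> \<and> x * y = \<pi>)"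
proof (cases "x = y")
  case True
  have "(4 * a - 4) * x\<^sup>2 - (4 * a + 2 * b - 4) * x + (a + b)
      = - ((2 * a + b - 2) * (x + x - 2 * x * x) - a - b * (1 - x\<^sup>2 - x\<^sup>2))"
    by (simp add: power2_eq_square algebra_simps)
  then show ?thesis
    using True by (auto simp: balanced_pairs_def ricci_balanced_eq_iff)
next
  case False
  have n: "2 * a + b - 2 = a * \<sigma>"
    using a by (simp add: \<sigma>_def)
  have "a * (x + y) - (2 * a + b - 2) = 0 \<longleftrightarrow> x + y = \<sigma>"
    unfolding n using a by (simp flip: right_diff_distrib)
  moreover have "(2 * a + b - 2) * (x + y - 2 * x * y) - a - b * (1 - x\<^sup>2 - y\<^sup>2) = 0 \<longleftrightarrow> x * y = \<pi>"
    if "x + y = \<sigma>"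
  proof -
    have "(2 * a + b - 2) * (x + y - 2 * x * y) - a - b * (1 - x\<^sup>2 - y\<^sup>2)
        = (2 * a + b - 2) * (x + y) + b * (x + y)\<^sup>2 - a - b - 4 * (a + b - 1) * (x * y)"
      by (simp add: power2_eq_square algebra_simps)
    also have "\<dots> = (a + b) * (\<sigma>\<^sup>2 - 1) - 4 * (a + b - 1) * (x * y)"
      unfolding that n by (simp add: power2_eq_square algebra_simps)
    finally show ?thesis
      using a b by (auto simp: \<pi>_def field_simps)
  qed
  ultimately show ?thesis
    using False by (auto simp: balanced_pairs_def ricci_balanced_eq_iff)
qed

text \<open>The quadratic on the diagonal has discriminant 4 (b^2 - (4 a - 4)).\<close>

lemma balanced_pairs_eq_diagonal:
  fixes a b :: real
  assumes a: "a \<ge> 2" and b: "b \<ge> 1"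
  defines "D \<equiv> {(x, y). (x, y) \<in> balanced_pairs a a b \<and> x = y}"
  shows "b\<^sup>2 > 4 * a - 4 \<Longrightarrow> card D = 2" and "b\<^sup>2 < 4 * a - 4 \<Longrightarrow> D = {}"
proof -
  have disc: "(4 * a + 2 * b - 4)\<^sup>2 - 4 * (4 * a - 4) * (a + b) = 4 * (b\<^sup>2 - (4 * a - 4))"
    by (simp add: power2_eq_square algebra_simps)
  show "card D = 2" if "b\<^sup>2 > 4 * a - 4"
  proof -
    have "(4 * a + 2 * b - 4)\<^sup>2 - 4 * (4 * a - 4) * (a + b) > 0"
      unfolding disc using that by simp
    then have "(4 * a + 2 * b - 4)\<^sup>2 > 4 * (4 * a - 4) * (a + b)"
      by simp
    then obtain r1 r2 where r: "0 < r1" "r1 < r2"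
      "\<And>t. (4 * a - 4) * t\<^sup>2 - (4 * a + 2 * b - 4) * t + (a + b) = 0 \<longleftrightarrow> t = r1 \<or> t = r2"
      using a b quadratic_roots[of "4 * a - 4" "4 * a + 2 * b - 4" "a + b"] by auto
    have "D = {(r1, r1), (r2, r2)}"
      unfolding D_def using r by (auto simp: balanced_pairs_eq_iff[OF a b])
    then show ?thesis
      using r by simp
  qed
  show "D = {}" if "b\<^sup>2 < 4 * a - 4"
  proof -
    have "(4 * a + 2 * b - 4)\<^sup>2 - 4 * (4 * a - 4) * (a + b) < 0"
      unfolding disc using that by simp
    then have "(4 * a + 2 * b - 4)\<^sup>2 < 4 * (4 * a - 4) * (a + b)"
      by simp
    then have "(4 * a - 4) * t\<^sup>2 - (4 * a + 2 * b - 4) * t + (a + b) \<noteq> 0" for t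
      using a by (intro quadratic_no_root) simp_all
    then show ?thesis
      unfolding D_def by (auto simp: balanced_pairs_eq_iff[OF a b])
  qed
qed

text \<open>Here x and y are the two distinct roots of t^2 - \<sigma> t + \<pi>, in either order, so
  they exist in pairs. By \<open>disc\<close> the discriminant has the sign of a + b -
  \<sigma>^2.\<close>

lemma balanced_pairs_eq_off_diagonal:
  fixes a b :: real
  assumes a: "a \<ge> 2" and b: "b \<ge> 1"
  defines "F \<equiv> {(x, y). (x, y) \<in> balanced_pairs a a b \<and> x \<noteq> y}"
  shows "(2 * a + b - 2)\<^sup>2 < a\<^sup>2 * (a + b) \<Longrightarrow> card F = 2"
    and "(2 * a + b - 2)\<^sup>2 \<ge> a\<^sup>2 * (a + b) \<Longrightarrow> F = {}"
proof -
  define \<sigma> where "\<sigma> = (2 * a + b - 2) / a"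
  define \<pi> where "\<pi> = (a + b) * (\<sigma>\<^sup>2 - 1) / (4 * (a + b - 1))"
  have mem: "(x, y) \<in> F \<longleftrightarrow> x > 0 \<and> y > 0 \<and> x \<noteq> y \<and> x + y = \<sigma> \<and> x * y = \<pi>" for x y
    by (auto simp: F_def balanced_pairs_eq_iff[OF a b] \<sigma>_def \<pi>_def)
  have "\<sigma> > 1"
    using a b by (simp add: \<sigma>_def)
  then have "\<sigma>\<^sup>2 > 1"
    by simp
  then have \<pi>: "\<pi> > 0"
    using a b by (simp add: \<pi>_def)
  define c where "c = 4 * (a + b - 1)"
  have "c * \<pi> = (a + b) * (\<sigma>\<^sup>2 - 1)"
    using a b by (simp add: \<pi>_def flip: c_def) (simp add: c_def)
  then have disc: "(a + b - 1) * (\<sigma>\<^sup>2 - 4 * \<pi>) = a + b - \<sigma>\<^sup>2"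
    by (simp add: c_def algebra_simps)
  have \<sigma>2: "a\<^sup>2 * \<sigma>\<^sup>2 = (2 * a + b - 2)\<^sup>2"
    using a by (simp add: \<sigma>_def power_divide)
  show "card F = 2" if "(2 * a + b - 2)\<^sup>2 < a\<^sup>2 * (a + b)"
  proof -
    have "\<sigma>\<^sup>2 < a + b"
      using that a unfolding \<sigma>2[symmetric] by simp
    then have "0 < (a + b - 1) * (\<sigma>\<^sup>2 - 4 * \<pi>)"
      using disc by linarith
    then have "\<sigma>\<^sup>2 > 4 * 1 * \<pi>"
      using a b by (simp add: zero_less_mult_iff)
    then obtain r1 r2 where r: "0 < r1" "r1 < r2" "\<And>t. 1 * t\<^sup>2 - \<sigma> * t + \<pi> = 0 \<longleftrightarrow> t = r1 \<or> t = r2"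
      using \<pi> \<open>\<sigma> > 1\<close> quadratic_roots[of 1 \<sigma> \<pi>] by auto
    have "F = {(r1, r2), (r2, r1)}"
    proof (intro set_eqI iffI)
      fix p assume "p \<in> F"
      then obtain x y where p: "p = (x, y)" and xy: "x \<noteq> y" "x + y = \<sigma>" "x * y = \<pi>"
        using mem by (cases p) auto
      have "1 * x\<^sup>2 - \<sigma> * x + \<pi> = 0" "1 * y\<^sup>2 - \<sigma> * y + \<pi> = 0"
        unfolding xy(2,3)[symmetric] by (simp_all add: power2_eq_square algebra_simps)
      then show "p \<in> {(r1, r2), (r2, r1)}"
        using r(3) xy(1) p by auto
    next
      have "1 * r1\<^sup>2 - \<sigma> * r1 + \<pi> = 0" "1 * r2\<^sup>2 - \<sigma> * r2 + \<pi> = 0"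
        by (simp_all only: r(3) simp_thms)
      moreover from this have "(r2 - r1) * (r1 + r2 - \<sigma>) = 0"
        by (simp add: power2_eq_square algebra_simps)
      ultimately have sum: "r1 + r2 = \<sigma>" and "\<sigma> * r1 - r1\<^sup>2 = \<pi>"
        using r(2) by simp_all
      then have "r1 * r2 = \<pi>"
        unfolding sum[symmetric] by (simp add: power2_eq_square algebra_simps)
      fix p assume "p \<in> {(r1, r2), (r2, r1)}"
      then show "p \<in> F"
        using sum \<open>r1 * r2 = \<pi>\<close> r(1,2) by (auto simp: mem add.commute mult.commute)
    qed
    then show ?thesis
      using r(2) by simp
  qed
  show "F = {}" if "(2 * a + b - 2)\<^sup>2 \<ge> a\<^sup>2 * (a + b)"
  proof -
    have "\<sigma>\<^sup>2 \<ge> a + b"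
      using that a unfolding \<sigma>2[symmetric] by simp
    then have "(a + b - 1) * (\<sigma>\<^sup>2 - 4 * \<pi>) \<le> 0"
      using disc by linarith
    then have le: "\<sigma>\<^sup>2 \<le> 4 * \<pi>"
      using a b by (simp add: mult_le_0_iff)
    have "False" if "x \<noteq> y" "x + y = \<sigma>" "x * y = \<pi>" for x y
    proof -
      have "0 < (x - y)\<^sup>2"
        using that by simp
      also have "\<dots> = \<sigma>\<^sup>2 - 4 * \<pi>"
        unfolding that(2,3)[symmetric] by (simp add: power2_eq_square algebra_simps)
      finally show False
        using le by simp
    qed
    then show ?thesis
      using mem by auto
  qed
qed

lemma card_balanced_pairs_eq:
  fixes a b :: real
  assumes a: "a \<ge> 2" and b: "b \<ge> 1"
  shows "b\<^sup>2 > 4 * a - 4 \<Longrightarrow> (2 * a + b - 2)\<^sup>2 < a\<^sup>2 * (a + b) \<Longrightarrow> card (balanced_pairs a a b) = 4"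
    and "b\<^sup>2 < 4 * a - 4 \<Longrightarrow> (2 * a + b - 2)\<^sup>2 < a\<^sup>2 * (a + b) \<Longrightarrow> card (balanced_pairs a a b) = 2"
    and "b\<^sup>2 > 4 * a - 4 \<Longrightarrow> (2 * a + b - 2)\<^sup>2 \<ge> a\<^sup>2 * (a + b) \<Longrightarrow> card (balanced_pairs a a b) = 2"
proof -
  let ?D = "{(x, y). (x, y) \<in> balanced_pairs a a b \<and> x = y}"
  let ?F = "{(x, y). (x, y) \<in> balanced_pairs a a b \<and> x \<noteq> y}"
  have split: "balanced_pairs a a b = ?D \<union> ?F" "?D \<inter> ?F = {}"
    by auto
  have union: "card (balanced_pairs a a b) = card ?D + card ?F" if "finite ?D" "finite ?F"
    by (subst split(1), rule card_Un_disjoint[OF that split(2)])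
  note D = balanced_pairs_eq_diagonal[OF a b] and F = balanced_pairs_eq_off_diagonal[OF a b]
  have fin: "finite X" if "card X = 2" for X :: "(real \<times> real) set"
    using that by (metis card.infinite zero_neq_numeral)
  show "card (balanced_pairs a a b) = 4" if "b\<^sup>2 > 4 * a - 4" "(2 * a + b - 2)\<^sup>2 < a\<^sup>2 * (a + b)"
    unfolding union[OF fin[OF D(1)[OF that(1)]] fin[OF F(1)[OF that(2)]]] D(1)[OF that(1)] F(1)[OF that(2)]
    by simp
  show "card (balanced_pairs a a b) = 2" if "b\<^sup>2 < 4 * a - 4" "(2 * a + b - 2)\<^sup>2 < a\<^sup>2 * (a + b)"
    using union[unfolded D(2)[OF that(1)] F(1)[OF that(2)], OF finite.emptyI fin[OF F(1)[OF that(2)]]]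
    by simp
  show "card (balanced_pairs a a b) = 2" if "b\<^sup>2 > 4 * a - 4" "(2 * a + b - 2)\<^sup>2 \<ge> a\<^sup>2 * (a + b)"
    using union[unfolded D(1)[OF that(1)] F(2)[OF that(2)], OF fin[OF D(1)[OF that(1)]] finite.emptyI]
    by simp
qed

text \<open>Cyclic relabelling of the blocks moves the normalised coordinate from z to x, and
  dividing by x restores the normal form. It brings two equal sizes to the first two places.\<close>

lemma card_balanced_pairs_rotate: "card (balanced_pairs k l m) = card (balanced_pairs l m k)"
proof -
  have rotate: "ricci_balanced k l m x y z \<longleftrightarrow> ricci_balanced l m k y z x" for k l m x y z
    by (auto simp: ricci_balanced_def algebra_simps)
  have mem: "(y / x, 1 / x) \<in> balanced_pairs l m k \<longleftrightarrow> (x, y) \<in> balanced_pairs k l m" if "x > 0" for x y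
  proof -
    have "ricci_balanced l m k (y / x) (1 / x) 1 \<longleftrightarrow> ricci_balanced l m k (x * (y / x)) (x * (1 / x)) (x * 1)"
      by (rule ricci_balanced_scale[symmetric]) (use that in simp)
    also have "\<dots> \<longleftrightarrow> ricci_balanced k l m x y 1"
      using that rotate[of k l m x y 1] by simp
    finally show ?thesis
      using that by (simp add: balanced_pairs_def zero_less_divide_iff)
  qed
  have "bij_betw (\<lambda>(x, y). (y / x, 1 / x)) (balanced_pairs k l m) (balanced_pairs l m k)"
  proof (rule bij_betwI[where g="\<lambda>(x, y). (1 / y, x / y)"])
    show "(\<lambda>(x, y). (y / x, 1 / x)) \<in> balanced_pairs k l m \<rightarrow> balanced_pairs l m k"
      using mem by (auto simp: balanced_pairs_def)
    show "(\<lambda>(x, y). (1 / y, x / y)) \<in> balanced_pairs l m k \<rightarrow> balanced_pairs k l m"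
    proof (rule funcsetI)
      fix p assume p: "p \<in> balanced_pairs l m k"
      obtain x y where xy: "p = (x, y)"
        by (cases p)
      then have "y > 0"
        using p by (simp add: balanced_pairs_def)
      then show "(\<lambda>(x, y). (1 / y, x / y)) p \<in> balanced_pairs k l m"
        using mem[of "1 / y" "x / y"] p xy by simp
    qed
  qed (auto simp: balanced_pairs_def)
  then show ?thesis
    by (rule bij_betw_same_card)
qed

section \<open>Counting solutions: three distinct block sizes\<close>
text \<open>The analysis takes place over the reals; that the sizes are distinct integers enters
  through the gaps of at least 1.\<close>

locale distinct_sizes =
  fixes k l m :: real
  assumes m_ge: "m \<ge> 1" and l_ge: "l \<ge> m + 1" and k_ge: "k \<ge> l + 1"
begin

definition s :: real where "s = k + l"
definition p :: real where "p = k + l - 2"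
definition N :: real where "N = 2 * (k + l + m - 2)"
definition d :: real where "d = k - l"
definition q :: "real \<Rightarrow> real" where "q v = s * v - N"
definition g :: "real \<Rightarrow> real" where "g v = p * v\<^sup>2 - N * v + (s + 2 * m)"
definition h :: "real \<Rightarrow> real" where "h v = s * v\<^sup>2 - N * v + (s + 2 * m - 2)"
definition R :: "real \<Rightarrow> real" where "R v = (q v)\<^sup>2 * g v - d\<^sup>2 * h v"

lemmas defs = s_def p_def N_def d_def

lemma bounds: "s \<ge> 5" "p = s - 2" "p \<ge> 2 * m + 1" "N = 2 * p + 2 * m" "d \<ge> 1" "d \<le> s - 2 * (m + 1)" "N > 0"
  using m_ge l_ge k_ge by (simp_all add: defs)

text \<open>With \<open>v = x + y\<close> and \<open>x - y = d / q v\<close>, the inequality says that \<open>x\<close> and \<open>y\<close> are positive.\<close>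

definition admissible :: "real set" where
  "admissible = {v. d < v * \<bar>q v\<bar> \<and> R v = 0}"

text \<open>The equations in the coordinates v = x + y and u = x - y, with E3 taken out by the
  combination 2 E3 - E1 - E2.\<close>

lemma ricci_balanced_iff:
  "ricci_balanced k l m x y 1 \<longleftrightarrow> (x - y) * q (x + y) = d \<and>
     g (x + y) - (s + 2 * m - 2) * (x - y)\<^sup>2 - d * ((x - y) * (x + y)) = 0"
proof -
  define E1 E2 E3 where "E1 = 2 * (k + l + m - 2) * y * 1 + k * (x\<^sup>2 - y\<^sup>2 - 1\<^sup>2)"
    and "E2 = 2 * (k + l + m - 2) * x * 1 + l * (y\<^sup>2 - x\<^sup>2 - 1\<^sup>2)"
    and "E3 = 2 * (k + l + m - 2) * x * y + m * (1\<^sup>2 - x\<^sup>2 - y\<^sup>2)"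
  have "E1 - E2 = (x - y) * q (x + y) - d"
    "2 * E3 - E1 - E2 = g (x + y) - (s + 2 * m - 2) * (x - y)\<^sup>2 - d * ((x - y) * (x + y))"
    by (simp_all add: E1_def E2_def E3_def g_def q_def defs power2_eq_square algebra_simps)
  moreover have "ricci_balanced k l m x y 1 \<longleftrightarrow> E1 = E2 \<and> E2 = E3"
    by (simp add: ricci_balanced_def E1_def E2_def E3_def)
  moreover have "E1 = E2 \<and> E2 = E3 \<longleftrightarrow> E1 - E2 = 0 \<and> 2 * E3 - E1 - E2 = 0"
    by auto
  ultimately show ?thesis
    by auto
qed

text \<open>The origin of R: u = d / q v is substituted into the second equation and the denominator
  is cleared; \<open>h\<close> appears as v q v + (s + 2 m - 2).\<close>

lemma R_eq:
  assumes "u * q v = d"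
  shows "R v = (q v)\<^sup>2 * (g v - (s + 2 * m - 2) * u\<^sup>2 - d * (u * v))"
proof -
  have h: "h v = v * q v + (s + 2 * m - 2)"
    by (simp add: h_def q_def power2_eq_square algebra_simps)
  have "R v = (q v)\<^sup>2 * g v - (u * q v)\<^sup>2 * (s + 2 * m - 2) - d * (u * q v) * (v * q v)"
    unfolding R_def h assms by (simp add: power2_eq_square algebra_simps)
  then show ?thesis
    by (simp add: power2_eq_square algebra_simps)
qed

text \<open>Since d > 0, the factor q v cannot vanish at a solution, so v determines u = d / q v and
  with it both coordinates.\<close>

lemma card_balanced_pairs_admissible: "card (balanced_pairs k l m) = card admissible"
proof -
  have "d > 0"
    using bounds by linarith
  have "bij_betw (\<lambda>(x, y). x + y) (balanced_pairs k l m) admissible"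
  proof (rule bij_betwI[where g="\<lambda>v. ((v + d / q v) / 2, (v - d / q v) / 2)"])
    show "(\<lambda>(x, y). x + y) \<in> balanced_pairs k l m \<rightarrow> admissible"
    proof (rule funcsetI)
      fix z assume z: "z \<in> balanced_pairs k l m"
      obtain x y where xy: "z = (x, y)"
        by (cases z)
      then have pos: "x > 0" "y > 0" and u: "(x - y) * q (x + y) = d"
        and zero: "g (x + y) - (s + 2 * m - 2) * (x - y)\<^sup>2 - d * ((x - y) * (x + y)) = 0"
        using z by (auto simp: balanced_pairs_def ricci_balanced_iff)
      have "q (x + y) \<noteq> 0"
        using u \<open>d > 0\<close> by auto
      have "d = \<bar>x - y\<bar> * \<bar>q (x + y)\<bar>"
        using u \<open>d > 0\<close> by (metis abs_mult abs_of_pos)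
      also have "\<dots> < (x + y) * \<bar>q (x + y)\<bar>"
        using pos \<open>q (x + y) \<noteq> 0\<close> by (intro mult_strict_right_mono) auto
      finally show "(\<lambda>(x, y). x + y) z \<in> admissible"
        using R_eq[OF u] zero by (simp add: admissible_def xy)
    qed
    show "(\<lambda>v. ((v + d / q v) / 2, (v - d / q v) / 2)) \<in> admissible \<rightarrow> balanced_pairs k l m"
    proof (rule funcsetI)
      fix v assume "v \<in> admissible"
      then have v: "d < v * \<bar>q v\<bar>" "R v = 0"
        by (auto simp: admissible_def)
      have "q v \<noteq> 0"
        using v(1) \<open>d > 0\<close> by auto
      define u where "u = d / q v"
      have u: "u * q v = d"
        using \<open>q v \<noteq> 0\<close> by (simp add: u_def)
      have "\<bar>u\<bar> * \<bar>q v\<bar> < v * \<bar>q v\<bar>"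
        using v(1) u \<open>d > 0\<close> by (metis abs_mult abs_of_pos)
      then have "u < v" "- u < v"
        using \<open>q v \<noteq> 0\<close> by (simp_all add: abs_less_iff)
      have zero: "g v - (s + 2 * m - 2) * u\<^sup>2 - d * (u * v) = 0"
        using R_eq[OF u] v(2) \<open>q v \<noteq> 0\<close> by simp
      have "ricci_balanced k l m ((v + u) / 2) ((v - u) / 2) 1"
      proof -
        have sum: "(v + u) / 2 + (v - u) / 2 = v" and diff: "(v + u) / 2 - (v - u) / 2 = u"
          by (simp_all add: field_simps)
        show ?thesis
          unfolding ricci_balanced_iff sum diff using u zero by blast
      qed
      then show "((v + d / q v) / 2, (v - d / q v) / 2) \<in> balanced_pairs k l m"
        unfolding u_def[symmetric] balanced_pairs_def using \<open>u < v\<close> \<open>- u < v\<close> by simp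
    qed
  next
    fix z assume z: "z \<in> balanced_pairs k l m"
    obtain x y where xy: "z = (x, y)"
      by (cases z)
    then have u: "(x - y) * q (x + y) = d"
      using z by (auto simp: balanced_pairs_def ricci_balanced_iff)
    then have "d / q (x + y) = x - y"
      using \<open>d > 0\<close> by (metis less_irrefl mult_zero_right nonzero_mult_div_cancel_right)
    then show "(\<lambda>v. ((v + d / q v) / 2, (v - d / q v) / 2)) ((\<lambda>(x, y). x + y) z) = z"
      by (simp add: xy)
  next
    fix v assume "v \<in> admissible"
    show "(\<lambda>(x, y). x + y) ((\<lambda>v. ((v + d / q v) / 2, (v - d / q v) / 2)) v) = v"
      by (simp add: field_simps)
  qed
  then show ?thesis
    by (rule bij_betw_same_card)
qed

text \<open>R is a polynomial of degree 4 with leading coefficient s^2 p; the bound caps the count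
  once four roots are found.\<close>

lemma card_admissible_le: "finite admissible" "card admissible \<le> 4"
proof -
  define P where "P = [:- N, s:]\<^sup>2 * [:s + 2 * m, - N, p:] - smult (d\<^sup>2) [:s + 2 * m - 2, - N, s:]"
  have R: "poly P v = R v" for v
    by (simp add: P_def R_def q_def g_def h_def power2_eq_square algebra_simps)
  have "coeff P 4 = s\<^sup>2 * p"
    by (simp add: P_def power2_eq_square coeff_mult numeral_eq_Suc)
  then have "P \<noteq> 0"
    using bounds(1,2) by auto
  have "degree P \<le> 4"
    unfolding P_def power2_eq_square
    by (intro degree_diff_le order_trans[OF degree_mult_le] order_trans[OF degree_smult_le])
      (simp_all add: degree_mult_le)
  have sub: "admissible \<subseteq> {v. poly P v = 0}"
    by (auto simp: admissible_def R)
  show "finite admissible"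
    using finite_subset[OF sub] poly_roots_finite[OF \<open>P \<noteq> 0\<close>] by simp
  have "card admissible \<le> card {v. poly P v = 0}"
    by (rule card_mono[OF poly_roots_finite[OF \<open>P \<noteq> 0\<close>] sub])
  also have "\<dots> \<le> degree P"
    by (rule card_poly_roots_bound[OF \<open>P \<noteq> 0\<close>])
  finally show "card admissible \<le> 4"
    using \<open>degree P \<le> 4\<close> by simp
qed

section \<open>Sign changes of R and the branch s v > N\<close>

lemma isCont_R: "isCont R v"
proof -
  have "R = (\<lambda>v. (s * v - N)\<^sup>2 * (p * v\<^sup>2 - N * v + (s + 2 * m)) - d\<^sup>2 * (s * v\<^sup>2 - N * v + (s + 2 * m - 2)))"
    by (simp add: fun_eq_iff R_def q_def g_def h_def)
  then show ?thesis by simp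
qed

lemma R_root_up: "a \<le> b \<Longrightarrow> R a < 0 \<Longrightarrow> R b > 0 \<Longrightarrow> \<exists>v. a < v \<and> v < b \<and> R v = 0"
  using IVT[of R a 0 b] isCont_R by (metis less_irrefl order_le_less)

lemma R_root_down: "a \<le> b \<Longrightarrow> R a > 0 \<Longrightarrow> R b < 0 \<Longrightarrow> \<exists>v. a < v \<and> v < b \<and> R v = 0"
  using IVT2[of R b 0 a] isCont_R by (metis less_irrefl order_le_less)

text \<open>At this end of the admissible range u = v, that is y = 0, and R has the sign of 1 - v^2.
  The next lemma treats the ends where u = - v, that is x = 0.\<close>

lemma R_boundary_right:
  assumes "v * q v = d"
  shows "R v = 2 * (k + m) * (q v)\<^sup>2 * (1 - v\<^sup>2)"
proof -
  have sv: "s * v\<^sup>2 - N * v = d"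
    using assms by (simp add: q_def power2_eq_square algebra_simps)
  have g: "g v = d - 2 * v\<^sup>2 + (s + 2 * m)" and h: "h v = d + (s + 2 * m - 2)"
    unfolding g_def h_def bounds(2) using sv by (simp_all add: algebra_simps)
  have "R v = (q v)\<^sup>2 * g v - (v * q v)\<^sup>2 * h v"
    by (simp only: R_def assms)
  also have "\<dots> = (q v)\<^sup>2 * ((d + s + 2 * m) * (1 - v\<^sup>2))"
    unfolding g h by (simp add: algebra_simps)
  also have "d + s + 2 * m = 2 * (k + m)"
    by (simp add: d_def s_def)
  finally show ?thesis by (simp add: mult_ac)
qed

lemma R_boundary_left:
  assumes "v * q v = - d"
  shows "R v = 2 * (l + m) * (q v)\<^sup>2 * (1 - v\<^sup>2)"
proof -
  have sv: "s * v\<^sup>2 - N * v = - d"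
    using assms by (simp add: q_def power2_eq_square algebra_simps)
  have g: "g v = - d - 2 * v\<^sup>2 + (s + 2 * m)" and h: "h v = - d + (s + 2 * m - 2)"
    unfolding g_def h_def bounds(2) using sv by (simp_all add: algebra_simps)
  have "R v = (q v)\<^sup>2 * g v - (- (v * q v))\<^sup>2 * h v"
    by (simp only: R_def assms minus_minus)
  also have "\<dots> = (q v)\<^sup>2 * ((- d + s + 2 * m) * (1 - v\<^sup>2))"
    unfolding g h by (simp add: algebra_simps)
  also have "- d + s + 2 * m = 2 * (l + m)"
    by (simp add: d_def s_def)
  finally show ?thesis by (simp add: mult_ac)
qed

lemma root_right_exists: "\<exists>v. v \<in> admissible \<and> q v > 0"
proof -
  have q_mono: "q a < q b" if "a < b" for a b
    using that bounds(1) by (simp add: q_def)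
  have "isCont (\<lambda>v. v * q v) v" for v
    by (simp add: q_def)
  moreover have "N / s * q (N / s) = 0"
    using bounds(1) by (simp add: q_def)
  moreover have "(N + d) * q (N + d) \<ge> d"
  proof -
    have "N * s \<ge> N * 1" "d * s \<ge> d * 1"
      using bounds by (intro mult_left_mono; linarith)+
    then have "q (N + d) \<ge> d"
      by (simp add: q_def algebra_simps)
    moreover have "N + d \<ge> 1"
      using bounds by linarith
    ultimately show ?thesis
      using mult_mono[of 1 "N + d" d "q (N + d)"] bounds by simp
  qed
  moreover have "N / s \<le> N + d"
  proof -
    have "N / s \<le> N / 1"
      using bounds by (intro divide_left_mono) simp_all
    then show ?thesis
      using bounds by simp
  qed
  ultimately obtain a where a: "N / s \<le> a" "a * q a = d"
    using IVT[of "\<lambda>v. v * q v" "N / s" d "N + d"] bounds by auto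
  have "a > 0"
    using a(1) bounds divide_pos_pos[of N s] by linarith
  then have "q a > 0"
    using a(2) bounds(5) by (metis less_le_trans zero_less_mult_pos zero_less_one)
  have "q 1 < 0"
    using m_ge l_ge k_ge by (simp add: q_def s_def N_def)
  then have "a > 1"
    using q_mono[of a 1] \<open>q a > 0\<close> by (cases a "1 :: real" rule: linorder_cases) auto
  then have "a\<^sup>2 > 1"
    by simp
  then have "R a < 0"
    unfolding R_boundary_right[OF a(2)] using \<open>q a > 0\<close> m_ge l_ge k_ge by (intro mult_pos_neg) simp_all
  \<comment> \<open>Any large point serves; this one exceeds a, N and d, so that q b is at least 4 b
    and g b at least b^2. Then the term 15 d^2 b^2 outweighs the correction 2 d^2 b^2 coming from h
    - g.\<close>
  define b where "b = a + N + d"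
  have "a < b"
    using bounds by (simp add: b_def)
  have "b \<ge> N" "b \<ge> d" "b > 1"
    using bounds \<open>a > 1\<close> by (simp_all add: b_def)
  have qb: "q b \<ge> 4 * b"
  proof -
    have "5 * b \<le> s * b"
      using bounds \<open>b > 1\<close> by (intro mult_right_mono) simp_all
    then show ?thesis
      using \<open>b \<ge> N\<close> by (simp add: q_def)
  qed
  have "g b \<ge> b\<^sup>2"
  proof -
    have "3 * b\<^sup>2 \<le> p * b\<^sup>2" "N * b \<le> b\<^sup>2"
      using bounds m_ge \<open>b \<ge> N\<close> \<open>b > 1\<close> by (auto simp: power2_eq_square intro!: mult_right_mono)
    moreover have "0 \<le> b\<^sup>2"
      by simp
    ultimately show ?thesis
      using bounds m_ge unfolding g_def by linarith
  qed
  have "(q b)\<^sup>2 \<ge> (4 * d)\<^sup>2"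
    using qb \<open>b \<ge> d\<close> bounds by (intro power_mono) simp_all
  then have "16 * d\<^sup>2 \<le> (q b)\<^sup>2"
    by (simp add: power_mult_distrib)
  then have "15 * d\<^sup>2 \<le> (q b)\<^sup>2 - d\<^sup>2" "0 \<le> (q b)\<^sup>2 - d\<^sup>2"
    using zero_le_power2[of d] by linarith+
  then have "15 * d\<^sup>2 * b\<^sup>2 \<le> ((q b)\<^sup>2 - d\<^sup>2) * g b"
    using \<open>g b \<ge> b\<^sup>2\<close> by (intro mult_mono) simp_all
  moreover have h: "h b = g b + 2 * b\<^sup>2 - 2"
    by (simp add: g_def h_def bounds(2) algebra_simps)
  have "R b = ((q b)\<^sup>2 - d\<^sup>2) * g b - 2 * d\<^sup>2 * b\<^sup>2 + 2 * d\<^sup>2"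
    unfolding R_def h by (simp add: algebra_simps)
  moreover have "d\<^sup>2 * b\<^sup>2 \<ge> 0" "d\<^sup>2 > 0"
    using bounds by simp_all
  ultimately have "R b > 0"
    by linarith
  then obtain v where v: "a < v" "R v = 0"
    using R_root_up[of a b] \<open>a < b\<close> \<open>R a < 0\<close> by auto
  have "q v > q a"
    using q_mono v(1) by simp
  then have "v * q v > d"
    using a(2) v(1) \<open>a > 0\<close> \<open>q a > 0\<close> mult_strict_mono[of a v "q a" "q v"] by simp
  then show ?thesis
    using v(2) \<open>q v > q a\<close> \<open>q a > 0\<close> by (intro exI[of _ v]) (simp add: admissible_def)
qed

text \<open>Descartes' rule of signs: \<open>R v / (q v)\<^sup>2\<close> is the sum of increasing monomials in \<open>q v\<close> and a constant.\<close>

lemma root_right_unique: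
  assumes "q v > 0" "R v = 0" "q w > 0" "R w = 0"
  shows "v = w"
proof -
  have no: False if vw: "v < w" "q v > 0" "R v = 0" "q w > 0" "R w = 0" for v w
  proof -
    \<comment> \<open>In terms of t = q v, the quotient s^2 R v / t^2 equals G t + C. The factor s^2
      clears the denominators of v = (t + N) / s, and s > 4 makes the linear coefficient positive.
      All terms of indefinite sign sit in the constant C.\<close>
    define G where "G t = p * t\<^sup>2 + N * (s - 4) * t - d\<^sup>2 * N * s * (1 / t) - d\<^sup>2 * (s + 2 * m - 2) * s\<^sup>2 * (1 / t)\<^sup>2" for t
    define C where "C = s\<^sup>2 * (s + 2 * m) - 2 * N\<^sup>2 - s * d\<^sup>2"
    have G: "G (q v) + C = 0" if "q v > 0" "R v = 0" for v
    proof -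
      define t where "t = q v"
      have t: "t > 0" "v = (t + N) / s"
        using that bounds by (simp_all add: t_def q_def)
      have g: "s\<^sup>2 * g v = p * t\<^sup>2 + N * (s - 4) * t + s\<^sup>2 * (s + 2 * m) - 2 * N\<^sup>2"
        using bounds by (simp add: g_def t(2) bounds(2) power2_eq_square field_simps)
      have h: "s * h v = t\<^sup>2 + N * t + s * (s + 2 * m - 2)"
        using bounds by (simp add: h_def t(2) power2_eq_square field_simps)
      have "t\<^sup>2 * (s\<^sup>2 * g v) - s * d\<^sup>2 * (s * h v) = s\<^sup>2 * R v"
        by (simp add: R_def t_def power2_eq_square algebra_simps)
      then have zero: "t\<^sup>2 * (p * t\<^sup>2 + N * (s - 4) * t + s\<^sup>2 * (s + 2 * m) - 2 * N\<^sup>2)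
          - s * d\<^sup>2 * (t\<^sup>2 + N * t + s * (s + 2 * m - 2)) = 0"
        unfolding g h that(2) by simp
      have inv: "t\<^sup>2 * (1 / t) = t" "t\<^sup>2 * (1 / t)\<^sup>2 = 1"
        using t(1) by (simp_all add: power2_eq_square)
      have "t\<^sup>2 * (G t + C) = t\<^sup>2 * (p * t\<^sup>2 + N * (s - 4) * t + C)
          - d\<^sup>2 * N * s * (t\<^sup>2 * (1 / t)) - d\<^sup>2 * (s + 2 * m - 2) * s\<^sup>2 * (t\<^sup>2 * (1 / t)\<^sup>2)"
        by (simp only: G_def) (simp only: algebra_simps)
      also have "\<dots> = 0"
        unfolding inv C_def using zero by (simp add: power2_eq_square algebra_simps)
      finally have "t\<^sup>2 * (G t + C) = 0" .
      then show ?thesis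
        using t(1) by (simp add: t_def)
    qed
    have lt: "q v < q w"
      using vw(1) bounds(1) by (simp add: q_def)
    have "G (q v) < G (q w)"
    proof -
      have inv: "1 / q w < 1 / q v"
        using lt vw by (intro divide_strict_left_mono) simp_all
      have "p * (q v)\<^sup>2 < p * (q w)\<^sup>2"
        using lt vw bounds m_ge by (intro mult_strict_left_mono power_strict_mono) simp_all
      moreover have "N * (s - 4) * q v < N * (s - 4) * q w"
        using lt bounds by (intro mult_strict_left_mono) simp_all
      moreover have "d\<^sup>2 * N * s * (1 / q w) \<le> d\<^sup>2 * N * s * (1 / q v)"
        using inv bounds by (intro mult_left_mono) simp_all
      moreover have "d\<^sup>2 * (s + 2 * m - 2) * s\<^sup>2 * (1 / q w)\<^sup>2 \<le> d\<^sup>2 * (s + 2 * m - 2) * s\<^sup>2 * (1 / q v)\<^sup>2"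
        using inv vw bounds m_ge by (intro mult_left_mono power_mono) simp_all
      ultimately show ?thesis
        unfolding G_def by linarith
    qed
    then show False
      using G[OF vw(2,3)] G[OF vw(4,5)] by linarith
  qed
  show ?thesis
    using no[of v w] no[of w v] assms by (cases v w rule: linorder_cases) auto
qed

text \<open>On this branch the range ends where x = 0. The point v = 1 lies strictly inside because
  q 1 < - d, so the two ends lie on either side of 1 and \<open>R_boundary_left\<close> gives R
  opposite signs there.\<close>

lemma left_interval:
  obtains v1 v2 where "0 < v1" "v1 < 1" "1 < v2" "R v1 > 0" "R v2 < 0"
    "\<And>v. v1 < v \<Longrightarrow> (v < v2 \<longleftrightarrow> d < v * - q v)" "q v2 < 0"
proof -
  have cont: "isCont (\<lambda>v. v * - q v) v" for v
    by (simp add: q_def)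
  have "q 1 < - d"
    using m_ge l_ge k_ge by (simp add: q_def s_def N_def d_def)
  have "1 < N / s"
    using m_ge l_ge k_ge by (simp add: s_def N_def)
  have d: "d > 0"
    using bounds by linarith
  obtain v1 where v1: "0 \<le> v1" "v1 \<le> 1" "v1 * - q v1 = d"
    using IVT[of "\<lambda>v. v * - q v" 0 d 1] cont d \<open>q 1 < - d\<close> by auto
  obtain v2 where v2: "1 \<le> v2" "v2 \<le> N / s" "v2 * - q v2 = d"
    using IVT2[of "\<lambda>v. v * - q v" "N / s" d 1] cont d \<open>q 1 < - d\<close> \<open>1 < N / s\<close> bounds(1)
    by (auto simp: q_def)
  have "v1 \<noteq> 0" "v1 \<noteq> 1" "v2 \<noteq> 1"
    using v1 v2 d \<open>q 1 < - d\<close> by auto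
  then have v12: "0 < v1" "v1 < 1" "1 < v2"
    using v1 v2 by auto
  have "q v1 < 0" "q v2 < 0"
    using v1(3) v2(3) v12 d zero_less_mult_pos[of v1 "- q v1"] zero_less_mult_pos[of v2 "- q v2"] by simp_all
  then have "(q v1)\<^sup>2 > 0" "(q v2)\<^sup>2 > 0"
    by simp_all
  have "v1\<^sup>2 < 1" "v2\<^sup>2 > 1"
    using v12 by (simp_all add: power_less_one_iff)
  have "R v1 > 0"
    using R_boundary_left[of v1] v1(3) \<open>v1\<^sup>2 < 1\<close> \<open>(q v1)\<^sup>2 > 0\<close> m_ge l_ge by simp
  have "R v2 < 0"
  proof -
    have "2 * (l + m) * (q v2)\<^sup>2 * (1 - v2\<^sup>2) < 0"
      using \<open>v2\<^sup>2 > 1\<close> \<open>(q v2)\<^sup>2 > 0\<close> m_ge l_ge by (intro mult_pos_neg) simp_all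
    then show ?thesis
      using R_boundary_left[of v2] v2(3) by simp
  qed
  have "s * v1\<^sup>2 - N * v1 + d = 0" "s * v2\<^sup>2 - N * v2 + d = 0"
    using v1(3) v2(3) by (simp_all add: q_def power2_eq_square algebra_simps)
  moreover from this have "(v2 - v1) * (s * (v1 + v2) - N) = 0"
    by (simp add: power2_eq_square algebra_simps)
  ultimately have N: "N = s * (v1 + v2)" and "N * v1 - s * v1\<^sup>2 = d"
    using v12 by simp_all
  then have d_eq: "d = s * v1 * v2"
    by (simp add: power2_eq_square algebra_simps)
  \<comment> \<open>Vieta's relations for v1 and v2 as the roots of s v^2 - N v + d.\<close>
  have factor: "v * - q v - d = s * (v - v1) * (v2 - v)" for v
    unfolding d_eq by (simp add: q_def N power2_eq_square algebra_simps)
  have "v < v2 \<longleftrightarrow> d < v * - q v" if "v1 < v" for v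
  proof -
    have "s * (v - v1) > 0"
      using that bounds by simp
    then have "0 < s * (v - v1) * (v2 - v) \<longleftrightarrow> v < v2"
      by (auto simp: zero_less_mult_iff[of "s * (v - v1)" "v2 - v"])
    then show ?thesis
      using factor[of v] by linarith
  qed
  then show thesis
    using that v12 \<open>R v1 > 0\<close> \<open>R v2 < 0\<close> \<open>q v2 < 0\<close> by blast
qed

section \<open>The branch s v < N\<close>

lemma s_eq: "s = p + 2"
  using bounds(2) by simp

lemma q_strict_mono: "v < w \<Longrightarrow> q v < q w"
  using bounds(1) by (simp add: q_def)

lemma admissible_left_exists: "\<exists>v. v \<in> admissible \<and> q v < 0"
proof -
  obtain v1 v2 where v: "0 < v1" "v1 < 1" "1 < v2" "R v1 > 0" "R v2 < 0"
    "\<And>v. v1 < v \<Longrightarrow> (v < v2 \<longleftrightarrow> d < v * - q v)" "q v2 < 0"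
    by (rule left_interval) blast
  obtain a where a: "v1 < a" "a < v2" "R a = 0"
    using R_root_down[of v1 v2] v by auto
  then have "q a < 0" "d < a * - q a"
    using v(6)[of a] v(7) q_strict_mono[of a v2] by auto
  then show ?thesis
    using a(3) by (intro exI[of _ a]) (simp add: admissible_def)
qed

text \<open>The condition says u = v - 2, that is y = 1. With y = z = 1 and E1 = E2, the combination
  2 E3 - E1 - E2 equals 2 (E3 - E2) = 2 (l - m) x^2 with x = v - 1, so its sign is known.\<close>

lemma R_edge:
  assumes "(2 - v) * - q v = d"
  shows "R v = (q v)\<^sup>2 * (2 * (l - m) * (v - 1)\<^sup>2)"
proof -
  have u: "(v - 2) * q v = d"
    using assms by (simp add: algebra_simps)
  have "g v - (s + 2 * m - 2) * (v - 2)\<^sup>2 - d * ((v - 2) * v) = 2 * (l - m) * (v - 1)\<^sup>2 - ((v - 2) * q v - d)"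
    by (simp add: g_def q_def defs power2_eq_square algebra_simps)
  then show ?thesis
    unfolding R_eq[OF u] using u by simp
qed

text \<open>R is positive, negative, positive, negative at v1 < v0 < v3 < v2. The three roots in
  between and the root with q > 0 exhaust the degree.\<close>

lemma card_admissible_four:
  assumes m: "m\<^sup>2 > 2 * p"
  shows "card admissible = 4"
proof -
  have "p > 0" "d > 0"
    using bounds m_ge by linarith+
  have "m * m > 4 * m"
    using m bounds(3) by (simp add: power2_eq_square)
  then have "m > 4"
    using m_ge by simp
  define v0 where "v0 = 1 + m / p"
  have pv0: "p * v0 = p + m"
    using \<open>p > 0\<close> by (simp add: v0_def algebra_simps)
  have "v0 > 1"
    using \<open>p > 0\<close> m_ge by (simp add: v0_def)
  \<comment> \<open>The minimum of g is negative exactly when m^2 > 2 p = 2 k + 2 l - 4, which is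
    the hypothesis on m.\<close>
  have "p * g v0 = 2 * p - m\<^sup>2"
  proof -
    have "p * g v0 = (p * v0)\<^sup>2 - N * (p * v0) + p * (s + 2 * m)"
      by (simp add: g_def power2_eq_square algebra_simps)
    also have "\<dots> = 2 * p - m\<^sup>2"
      unfolding pv0 bounds(4) s_eq by (simp add: power2_eq_square algebra_simps)
    finally show ?thesis .
  qed
  then have g0: "g v0 < 0"
    using m \<open>p > 0\<close> by (metis diff_less_0_iff_less less_asym mult_less_0_iff)
  have pq0: "p * - q v0 = (p + m) * (p - 2)"
  proof -
    have "p * - q v0 = p * N - s * (p * v0)"
      by (simp add: q_def algebra_simps)
    then show ?thesis
      unfolding pv0 bounds(4) s_eq by (simp add: algebra_simps)
  qed
  \<comment> \<open>Multiplied by p^2 and with p - d = 2 l - 2, the claim reads m^2 (p - 2) < p^2 (2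
    l - 4). It follows from m \<le> l - 1 and m \<le> p / 2. It leaves room for a point with y = 1
    beyond v0.\<close>
  have f0: "(2 - v0) * - q v0 > d"
  proof -
    have "m * m \<le> (l - 1) * (p / 2)"
      using l_ge bounds(3) m_ge by (intro mult_mono) simp_all
    then have "m\<^sup>2 * (p - 2) \<le> (l - 1) * (p / 2) * (p - 2)"
      using bounds(3) m_ge by (intro mult_right_mono) (simp_all add: power2_eq_square)
    also have "\<dots> < (l - 1) * (p / 2) * p"
      using l_ge m_ge \<open>p > 0\<close> by (intro mult_strict_left_mono) simp_all
    also have "\<dots> = p * p * ((l - 1) / 2)"
      by simp
    also have "\<dots> \<le> p * p * (2 * l - 4)"
      using l_ge \<open>m > 4\<close> by (intro mult_left_mono) simp_all
    finally have "d * p\<^sup>2 < (p - m) * ((p + m) * (p - 2))"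
      unfolding defs by (simp add: power2_eq_square algebra_simps)
    also have "\<dots> = (2 * p - p * v0) * (p * - q v0)"
      unfolding pq0 pv0 by simp
    also have "\<dots> = (2 - v0) * - q v0 * p\<^sup>2"
      by (simp add: power2_eq_square algebra_simps)
    finally show ?thesis
      using \<open>p > 0\<close> by (simp only: mult_less_cancel_right_pos zero_less_power)
  qed
  have "- q v0 > 0"
  proof -
    have "p * - q v0 > 0"
      unfolding pq0 using bounds(3) m_ge by simp
    then show ?thesis
      using \<open>p > 0\<close> zero_less_mult_pos by blast
  qed
  \<comment> \<open>Since - q v0 exceeds d, both summands of R v0 = (q^2 - d^2) g - 2 d^2 (v0^2 - 1)
    are negative.\<close>
  have "- q v0 \<ge> (2 - v0) * - q v0"
    using \<open>v0 > 1\<close> \<open>- q v0 > 0\<close> mult_right_mono[of "2 - v0" 1 "- q v0"] by simp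
  then have "- q v0 > d"
    using f0 by linarith
  have R0: "R v0 < 0"
  proof -
    have "d\<^sup>2 < (- q v0)\<^sup>2"
      using \<open>- q v0 > d\<close> \<open>d > 0\<close> by (intro power_strict_mono) simp_all
    then have "((q v0)\<^sup>2 - d\<^sup>2) * g v0 < 0"
      using g0 by (intro mult_pos_neg) simp_all
    moreover have "d\<^sup>2 * (2 * v0\<^sup>2 - 2) > 0"
      using \<open>v0 > 1\<close> \<open>d > 0\<close> by (intro mult_pos_pos) simp_all
    moreover have "R v0 = ((q v0)\<^sup>2 - d\<^sup>2) * g v0 - d\<^sup>2 * (2 * v0\<^sup>2 - 2)"
      by (simp add: R_def g_def h_def bounds(2) algebra_simps)
    ultimately show ?thesis by linarith
  qed
  obtain v3 where v3: "v0 < v3" "v3 < 2" "q v3 < 0" "(2 - v3) * - q v3 = d"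
  proof -
    let ?f = "\<lambda>v. (2 - v) * - q v"
    \<comment> \<open>The product vanishes at the first zero of its two factors; up to there both
      are nonnegative, so the intermediate point has q < 0 and lies below 2.\<close>
    have zero: "?f (min 2 (N / s)) = 0"
      using bounds(1) by (auto simp: min_def q_def)
    have "v0 < N / s"
      using \<open>- q v0 > 0\<close> bounds(1) by (simp add: q_def field_simps)
    moreover have "v0 < 2"
      using f0 \<open>d > 0\<close> \<open>- q v0 > 0\<close> by (smt (verit) mult_nonpos_nonneg)
    ultimately have "v0 \<le> min 2 (N / s)"
      by simp
    moreover have "isCont ?f v" for v
      by (simp add: q_def)
    ultimately obtain v where v: "v0 \<le> v" "v \<le> min 2 (N / s)" "?f v = d"
      using IVT2[of ?f "min 2 (N / s)" d v0] zero f0 \<open>d > 0\<close> by auto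
    have "v \<noteq> v0"
      using v(3) f0 by auto
    moreover have "v < 2"
      using v \<open>d > 0\<close> by (cases "v = 2") auto
    moreover from this have "- q v > 0"
      using v(3) \<open>d > 0\<close> zero_less_mult_pos[of "2 - v" "- q v"] by simp
    ultimately show thesis
      using that[of v] v by simp
  qed
  have R3: "R v3 > 0"
  proof -
    have "(q v3)\<^sup>2 > 0" "(v3 - 1)\<^sup>2 > 0"
      using v3 \<open>v0 > 1\<close> by simp_all
    then show ?thesis
      unfolding R_edge[OF v3(4)] using l_ge by simp
  qed
  obtain v1 v2 where v: "0 < v1" "v1 < 1" "1 < v2" "R v1 > 0" "R v2 < 0"
    "\<And>v. v1 < v \<Longrightarrow> (v < v2 \<longleftrightarrow> d < v * - q v)" "q v2 < 0"
    by (rule left_interval) blast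
  \<comment> \<open>As v3 > 1, the factor 2 - v3 is smaller than v3, so the point with y = 1 lies
    inside the admissible range.\<close>
  have "d < v3 * - q v3"
    unfolding v3(4)[symmetric] using v3 \<open>v0 > 1\<close> by (intro mult_strict_right_mono) simp_all
  then have "v3 < v2"
    using v(6)[of v3] v(2) v3(1) \<open>v0 > 1\<close> by simp
  obtain a where a: "v1 < a" "a < v0" "R a = 0"
    using R_root_down[of v1 v0] v R0 \<open>v0 > 1\<close> by auto
  obtain b where b: "v0 < b" "b < v3" "R b = 0"
    using R_root_up[of v0 v3] v3 R0 R3 by auto
  obtain e where e: "v3 < e" "e < v2" "R e = 0"
    using R_root_down[of v3 v2] \<open>v3 < v2\<close> v R3 by auto
  have left: "x \<in> admissible \<and> q x < 0" if "v1 < x" "x < v2" "R x = 0" for x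
    using that v(6)[of x] v(7) q_strict_mono[of x v2] by (auto simp: admissible_def)
  obtain r where r: "r \<in> admissible" "q r > 0"
    using root_right_exists by blast
  have abe: "a \<in> admissible" "b \<in> admissible" "e \<in> admissible" "q a < 0" "q b < 0" "q e < 0"
    using left[of a] left[of b] left[of e] a b e \<open>v3 < v2\<close> v(2) \<open>v0 > 1\<close> v3(1) by auto
  then have distinct: "a < b" "b < e" "r \<noteq> a" "r \<noteq> b" "r \<noteq> e"
    using a b e r(2) by auto
  have "card {a, b, e, r} = 4"
    using distinct by auto
  moreover have "{a, b, e, r} \<subseteq> admissible"
    using abe r(1) by simp
  ultimately show ?thesis
    using card_mono[OF card_admissible_le(1), of "{a, b, e, r}"] card_admissible_le(2) by simp
qed

text \<open>The expression is g^2 times the derivative of the function \<Psi> in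
  \<open>root_left_unique\<close>. When the bracket is negative, d is replaced by its upper bound s
  - 4 and g^2 by 4 g - 4. This leaves the quadratic Q in v - 1, whose discriminant is
  negative.\<close>

lemma derivative_numerator_pos:
  assumes m: "m\<^sup>2 \<le> p - 1 \<or> 3 \<le> m \<and> m\<^sup>2 \<le> p + 1" and v: "v \<ge> 1" and g: "g v > 0"
  shows "0 < s * (g v)\<^sup>2 + d * (4 * v - N * (v - 1)\<^sup>2)"
proof (cases "4 * v - N * (v - 1)\<^sup>2 \<ge> 0")
  case True
  then have "0 \<le> d * (4 * v - N * (v - 1)\<^sup>2)"
    using bounds(5) by simp
  moreover have "0 < s * (g v)\<^sup>2"
    using bounds(1) g by simp
  ultimately show ?thesis by linarith
next
  case False
  define y where "y = v - 1"
  have gy: "g v = p * y\<^sup>2 - 2 * m * y + 2"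
    by (simp add: g_def y_def bounds(2,4) power2_eq_square algebra_simps)
  let ?B = "2 * m * (p + 2) - (p - 2)" and ?A = "4 * p * (p + 2) - (p - 2) * (2 * p + 2 * m)"
  have p: "p \<ge> 3"
    using bounds(3) m_ge by linarith
  have disc: "?B\<^sup>2 < 2 * p * ?A"
  proof -
    have B: "?B\<^sup>2 = m\<^sup>2 * (2 * (p + 2))\<^sup>2 - 4 * m * (p\<^sup>2 - 4) + (p - 2)\<^sup>2"
      by (simp add: power2_eq_square algebra_simps)
    have A: "2 * p * ?A = 4 * p ^ 3 + 24 * p\<^sup>2 - 4 * p\<^sup>2 * m + 8 * p * m"
      by (simp add: power2_eq_square power3_eq_cube algebra_simps)
    show ?thesis
      using m
    proof
      assume "m\<^sup>2 \<le> p - 1"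
      then have "m\<^sup>2 * (2 * (p + 2))\<^sup>2 \<le> (p - 1) * (2 * (p + 2))\<^sup>2"
        by (rule mult_right_mono) simp
      then have "2 * p * ?A - ?B\<^sup>2 \<ge> 11 * p\<^sup>2 + 4 * p + 12 + 8 * m * (p - 2)"
        unfolding A B by (simp add: power2_eq_square power3_eq_cube algebra_simps)
      moreover have "8 * m * (p - 2) \<ge> 0" "p\<^sup>2 \<ge> 0"
        using p m_ge by simp_all
      ultimately show ?thesis
        using p by linarith
    next
      assume m3: "3 \<le> m \<and> m\<^sup>2 \<le> p + 1"
      then have "3 * 3 \<le> m * m"
        by (intro mult_mono) simp_all
      then have "p \<ge> 8"
        using m3 by (simp add: power2_eq_square)
      have "m\<^sup>2 * (2 * (p + 2))\<^sup>2 \<le> (p + 1) * (2 * (p + 2))\<^sup>2"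
        using m3 by (intro mult_right_mono) simp_all
      then have "2 * p * ?A - ?B\<^sup>2 \<ge> 3 * p\<^sup>2 - 28 * p - 20 + 8 * m * (p - 2)"
        unfolding A B by (simp add: power2_eq_square power3_eq_cube algebra_simps)
      moreover have "8 * m * (p - 2) \<ge> 24 * (p - 2)"
        using m3 \<open>p \<ge> 8\<close> by (intro mult_right_mono) simp_all
      moreover have "p\<^sup>2 \<ge> 8 * p"
        using \<open>p \<ge> 8\<close> by (simp add: power2_eq_square)
      then have "3 * (p\<^sup>2 - 8 * p) + (20 * p - 68) > 0"
        using \<open>p \<ge> 8\<close> by (intro add_nonneg_pos) simp_all
      then have "3 * p\<^sup>2 - 28 * p - 20 + 24 * (p - 2) > 0"
        by (simp add: algebra_simps)
      ultimately have "2 * p * ?A - ?B\<^sup>2 > 0"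
        by linarith
      then show ?thesis
        by simp
    qed
  qed
  define Q where "Q = s * (4 * g v - 4) + (s - 4) * (4 * v - N * (v - 1)\<^sup>2)"
  have Q: "Q = ?A * y\<^sup>2 - 4 * ?B * y + 8 * p"
    unfolding Q_def gy y_def[symmetric] bounds(4) s_eq
    by (simp add: y_def power2_eq_square algebra_simps)
  \<comment> \<open>The square is completed against the constant term 8 p, so for y = 0 the square
    itself is positive.\<close>
  have "2 * p * Q = (4 * p - ?B * y)\<^sup>2 + (2 * p * ?A - ?B\<^sup>2) * y\<^sup>2"
    unfolding Q by (simp add: power2_eq_square algebra_simps)
  also have "\<dots> > 0"
  proof (cases "y = 0")
    case True
    then show ?thesis using p by simp
  next
    case False
    then have "(2 * p * ?A - ?B\<^sup>2) * y\<^sup>2 > 0"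
      using disc by simp
    then show ?thesis
      by (intro add_nonneg_pos) simp_all
  qed
  finally have "Q > 0"
    using p by (simp add: zero_less_mult_iff)
  also have "Q \<le> s * (g v)\<^sup>2 + d * (4 * v - N * (v - 1)\<^sup>2)"
  proof -
    have "4 * g v - 4 \<le> (g v)\<^sup>2"
      using zero_le_power2[of "g v - 2"] by (simp add: power2_eq_square algebra_simps)
    then have "s * (4 * g v - 4) \<le> s * (g v)\<^sup>2"
      using bounds(1) by (intro mult_left_mono) simp_all
    moreover have "(s - 4) * (4 * v - N * (v - 1)\<^sup>2) \<le> d * (4 * v - N * (v - 1)\<^sup>2)"
      using False bounds(6) m_ge by (intro mult_right_mono_neg) simp_all
    ultimately show ?thesis
      unfolding Q_def by linarith
  qed
  finally show ?thesis .
qed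

text \<open>With F = (v^2 - 1) / g a root satisfies (q v)^2 = d^2 (1 + 2 F), and v > 1 gives - q v
  \<ge> d. The square root is avoided: for roots v < w, dividing the difference of the squares by 2
  d yields s (w - v) \<le> d (F v - F w), contradicting the monotonicity of s v + d F.\<close>

lemma root_left_unique:
  assumes m: "m\<^sup>2 \<le> p - 1 \<or> 3 \<le> m \<and> m\<^sup>2 \<le> p + 1"
    and v: "v \<in> admissible" "q v < 0" and w: "w \<in> admissible" "q w < 0"
  shows "v = w"
proof -
  have p: "p \<ge> 3" and "d > 0"
    using bounds m_ge by linarith+
  \<comment> \<open>Either hypothesis on m gives m^2 \<le> p + 1 < 2 p, so the minimum of g is
    positive.\<close>
  have g_pos: "g v > 0" for v
  proof -
    have "p * g v = (p * (v - 1) - m)\<^sup>2 + (2 * p - m\<^sup>2)"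
      by (simp add: g_def bounds(2,4) power2_eq_square algebra_simps)
    also have "\<dots> > 0"
      using m p by (intro add_nonneg_pos) auto
    finally show ?thesis
      using p by (simp add: zero_less_mult_iff)
  qed
  have hg: "h v = g v + 2 * (v\<^sup>2 - 1)" for v
    by (simp add: g_def h_def bounds(2) algebra_simps)
  have root: "v > 1 \<and> (q v)\<^sup>2 = d\<^sup>2 * (1 + 2 * ((v\<^sup>2 - 1) / g v))" if "v \<in> admissible" "q v < 0" for v
  proof -
    have "d < v * - q v" "R v = 0"
      using that by (auto simp: admissible_def)
    then have "v > 0"
      using that(2) \<open>d > 0\<close> by (metis less_trans neg_0_less_iff_less zero_less_mult_pos2)
    have Rv: "(q v)\<^sup>2 * g v = d\<^sup>2 * (g v + 2 * (v\<^sup>2 - 1))"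
      using \<open>R v = 0\<close> by (simp add: R_def hg)
    have "v > 1"
    proof (rule ccontr)
      assume "\<not> v > 1"
      then have "v\<^sup>2 \<le> 1" "q v \<le> q 1"
        using \<open>v > 0\<close> bounds(1) by (simp_all add: power_le_one q_def)
      moreover have "q 1 < - d"
        using l_ge m_ge by (simp add: q_def defs)
      ultimately have "d\<^sup>2 < (- q v)\<^sup>2"
        using \<open>d > 0\<close> by (intro power_strict_mono) simp_all
      then have "d\<^sup>2 * g v < (q v)\<^sup>2 * g v"
        using g_pos[of v] by simp
      also have "\<dots> \<le> d\<^sup>2 * g v"
        unfolding Rv using \<open>v\<^sup>2 \<le> 1\<close> by (intro mult_left_mono) simp_all
      finally show False by simp
    qed
    moreover have "(q v)\<^sup>2 = d\<^sup>2 * (1 + 2 * ((v\<^sup>2 - 1) / g v))"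
      using Rv g_pos[of v] by (simp add: field_simps)
    ultimately show ?thesis by blast
  qed
  define \<Psi> where "\<Psi> v = s * v + d * ((v\<^sup>2 - 1) / g v)" for v
  have \<Psi>_mono: "\<Psi> v < \<Psi> w" if "1 < v" "v < w" for v w
    using that(2)
  proof (rule DERIV_pos_imp_increasing)
    fix x assume "v \<le> x" "x \<le> w"
    have "((\<lambda>v. s * v + d * ((v\<^sup>2 - 1) / (p * v\<^sup>2 - N * v + (s + 2 * m)))) has_real_derivative
        s + d * ((2 * x * g x - (x\<^sup>2 - 1) * (2 * p * x - N)) / (g x)\<^sup>2)) (at x)"
      using g_pos[of x] by (auto intro!: derivative_eq_intros simp: g_def power2_eq_square) (simp add: algebra_simps)
    moreover have "2 * x * g x - (x\<^sup>2 - 1) * (2 * p * x - N) = 4 * x - N * (x - 1)\<^sup>2"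
      by (simp add: g_def bounds(2,4) power2_eq_square algebra_simps)
    moreover have "s + d * ((4 * x - N * (x - 1)\<^sup>2) / (g x)\<^sup>2) > 0"
    proof -
      have "0 < s * (g x)\<^sup>2 + d * (4 * x - N * (x - 1)\<^sup>2)"
        using derivative_numerator_pos[OF m] g_pos[of x] that(1) \<open>v \<le> x\<close> by simp
      then have "0 < (s * (g x)\<^sup>2 + d * (4 * x - N * (x - 1)\<^sup>2)) / (g x)\<^sup>2"
        using g_pos[of x] by simp
      then show ?thesis
        using g_pos[of x] by (simp add: add_divide_distrib)
    qed
    ultimately show "\<exists>y. (\<Psi> has_real_derivative y) (at x) \<and> 0 < y"
      unfolding \<Psi>_def[abs_def] g_def[symmetric] by auto
  qed
  have no: False if v: "v \<in> admissible" "q v < 0" and w: "w \<in> admissible" "q w < 0" and "v < w" for v w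
  proof -
    define A B where "A = - q v" and "B = - q w"
    define F where "F v = (v\<^sup>2 - 1) / g v" for v
    have F: "F v > 0" if "v > 1" for v
      using that g_pos[of v] by (simp add: F_def)
    have A: "v > 1" "A\<^sup>2 = d\<^sup>2 * (1 + 2 * F v)" and B: "w > 1" "B\<^sup>2 = d\<^sup>2 * (1 + 2 * F w)"
      using root[OF v] root[OF w] by (simp_all add: A_def B_def F_def)
    have AB: "A - B = s * (w - v)" "A > B" "A > 0" "B > 0"
      using \<open>v < w\<close> q_strict_mono[of v w] v(2) w(2) by (simp_all add: A_def B_def q_def algebra_simps)
    have ge: "d \<le> X" if "X > 0" "X\<^sup>2 = d\<^sup>2 * (1 + 2 * F v)" "v > 1" for X v
    proof -
      have "d\<^sup>2 * 1 \<le> X\<^sup>2"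
        unfolding that(2) using F[OF that(3)] by (intro mult_left_mono) simp_all
      then show ?thesis
        using that(1) by (intro power2_le_imp_le[of d X]) simp_all
    qed
    have "(A - B) * (2 * d) \<le> (A - B) * (A + B)"
      using AB ge[OF AB(3) A(2,1)] ge[OF AB(4) B(2,1)] by (intro mult_left_mono) simp_all
    also have "\<dots> = A\<^sup>2 - B\<^sup>2"
      by (simp add: power2_eq_square algebra_simps)
    also have "\<dots> = d * (F v - F w) * (2 * d)"
      unfolding A(2) B(2) by (simp add: power2_eq_square algebra_simps)
    finally have "A - B \<le> d * (F v - F w)"
      by (rule mult_right_le_imp_le) (use \<open>d > 0\<close> in simp)
    then have "\<Psi> w \<le> \<Psi> v"
      unfolding AB(1) by (simp add: \<Psi>_def F_def algebra_simps)
    then show False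
      using \<Psi>_mono[OF A(1) \<open>v < w\<close>] by simp
  qed
  show ?thesis
    using no[OF v w] no[OF w v] by (cases v w rule: linorder_cases) auto
qed

lemma card_admissible_two:
  assumes m: "m\<^sup>2 \<le> p - 1 \<or> 3 \<le> m \<and> m\<^sup>2 \<le> p + 1"
  shows "card admissible = 2"
proof -
  obtain r where r: "r \<in> admissible" "q r > 0"
    using root_right_exists by blast
  obtain e where e: "e \<in> admissible" "q e < 0"
    using admissible_left_exists by blast
  have "v = r \<or> v = e" if v: "v \<in> admissible" for v
  proof -
    have R: "R t = 0" if "t \<in> admissible" for t
      using that by (simp add: admissible_def)
    have "q v \<noteq> 0"
      using v bounds(5) by (auto simp: admissible_def)
    then consider "q v > 0" | "q v < 0"
      by linarith
    then show ?thesis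
    proof cases
      case 1
      then show ?thesis
        using root_right_unique[OF _ R[OF v] r(2) R[OF r(1)]] by simp
    next
      case 2
      then show ?thesis
        using root_left_unique[OF m v _ e] by simp
    qed
  qed
  then have "admissible = {r, e}"
    using r(1) e(1) by blast
  moreover have "r \<noteq> e"
    using r(2) e(2) by auto
  ultimately show ?thesis by simp
qed

end

section \<open>The number of invariant Einstein metrics\<close>
text \<open>The case a = b = 2 has to be kept out, since both sides equal 16 there.\<close>

lemma off_diagonal_condition_small:
  fixes a b :: nat
  assumes "1 \<le> b" "b \<le> a" "2 \<le> a" "a = 2 \<Longrightarrow> b = 1"
  shows "(2 * real a + real b - 2)\<^sup>2 < (real a)\<^sup>2 * (real a + real b)"
proof (cases "a = 2")
  case True
  then show ?thesis
    using assms by simp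
next
  case False
  define x y where "x = real a" and "y = real b"
  have x: "x \<ge> 3" and y: "1 \<le> y" "y \<le> x"
    using False assms by (simp_all add: x_def y_def)
  have T1: "x\<^sup>2 * (x - 3) + 4 * x - 1 > 0"
    using x by (intro add_nonneg_pos[of "x\<^sup>2 * (x - 3)" "4 * x - 1", simplified add_diff_eq]) simp_all
  have Tx: "(x - 2)\<^sup>2 * (2 * x - 1) > 0"
    using x by (intro mult_pos_pos) simp_all
  \<comment> \<open>The difference is concave in y with leading coefficient -1: it is the chord
    through its values at y = 1 and y = x plus (y - 1) (x - y), everything multiplied by x -
    1.\<close>
  have "(x - 1) * (x\<^sup>2 * (x + y) - (2 * x + y - 2)\<^sup>2)
      = (x - y) * (x\<^sup>2 * (x - 3) + 4 * x - 1) + (y - 1) * ((x - 2)\<^sup>2 * (2 * x - 1)) + (x - 1) * (y - 1) * (x - y)"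
    by (simp add: power2_eq_square algebra_simps)
  also have "\<dots> > 0"
  proof (cases "y = x")
    case True
    then have "(y - 1) * ((x - 2)\<^sup>2 * (2 * x - 1)) > 0"
      using Tx x by (intro mult_pos_pos) simp_all
    then show ?thesis
      using True by simp
  next
    case False
    then have "(x - y) * (x\<^sup>2 * (x - 3) + 4 * x - 1) > 0"
      using T1 y by (intro mult_pos_pos) simp_all
    moreover have "(y - 1) * ((x - 2)\<^sup>2 * (2 * x - 1)) \<ge> 0" "(x - 1) * (y - 1) * (x - y) \<ge> 0"
      using Tx x y by simp_all
    ultimately show ?thesis by linarith
  qed
  finally show ?thesis
    using x by (simp add: zero_less_mult_iff x_def y_def)
qed

text \<open>Half of a^2 exceeds X = a + b - 2 and the other half is at least 2 a, so a^2 - 2 a - X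
  is positive.\<close>

lemma off_diagonal_condition_large:
  fixes a b :: real
  assumes "a \<ge> 4" "b \<ge> a" "a\<^sup>2 > 2 * (a + b - 2)"
  shows "(2 * a + b - 2)\<^sup>2 < a\<^sup>2 * (a + b)"
proof -
  define X where "X = a + b - 2"
  have X: "X > 0" "2 * X < a\<^sup>2"
    using assms by (simp_all add: X_def)
  have "a\<^sup>2 \<ge> 4 * a"
    using assms by (simp add: power2_eq_square)
  then have "a\<^sup>2 - 2 * a - X > 0"
    using X by linarith
  then have "X * (a\<^sup>2 - 2 * a - X) + a\<^sup>2 > 0"
    using X by (intro add_pos_nonneg) simp_all
  also have "X * (a\<^sup>2 - 2 * a - X) + a\<^sup>2 = a\<^sup>2 * (a + b) - (2 * a + b - 2)\<^sup>2"
    by (simp add: X_def power2_eq_square algebra_simps)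
  finally show ?thesis by simp
qed

lemma card_balanced_pairs:
  fixes k l m :: nat
  assumes kl: "k \<ge> l" and lm: "l \<ge> m" and m: "m \<ge> 1" and l: "l \<ge> 2"
  shows "m\<^sup>2 + 4 > 2 * k + 2 * l \<Longrightarrow> card (balanced_pairs (real k) (real l) (real m)) = 4"
    and "m\<^sup>2 < k + l \<Longrightarrow> card (balanced_pairs (real k) (real l) (real m)) = 2"
proof -
  let ?card = "card (balanced_pairs (real k) (real l) (real m))"
  have sq: "(real n)\<^sup>2 = real (n\<^sup>2)" for n
    by simp
  consider "k = l" | "k > l" "l = m" | "k > l" "l > m"
    using kl lm by linarith
  then have "(m\<^sup>2 + 4 > 2 * k + 2 * l \<longrightarrow> ?card = 4) \<and> (m\<^sup>2 < k + l \<longrightarrow> ?card = 2)"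
  proof cases
    case 1
    \<comment> \<open>The sizes k = l = m = 2, where the off-diagonal criterion degenerates to an
      equality, satisfy neither of the two conditions on m.\<close>
    have m2: "m = 1" if "l = 2" "m\<^sup>2 + 4 > 2 * k + 2 * l \<or> m\<^sup>2 < k + l"
      using that 1 m lm by (cases "m = 2") auto
    have off: "(2 * real l + real m - 2)\<^sup>2 < (real l)\<^sup>2 * (real l + real m)"
      if "m\<^sup>2 + 4 > 2 * k + 2 * l \<or> m\<^sup>2 < k + l"
      using off_diagonal_condition_small[OF m lm l] m2 that by blast
    have "?card = 4" if "m\<^sup>2 + 4 > 2 * k + 2 * l"
    proof -
      have "real (m\<^sup>2 + 4) > real (4 * l)"
        using that 1 by (simp only: of_nat_less_iff)
      then show ?thesis
        unfolding 1 using off that m l by (intro card_balanced_pairs_eq(1)) simp_all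
    qed
    moreover have "?card = 2" if "m\<^sup>2 < k + l"
    proof -
      have "m\<^sup>2 < 2 * l"
        using that 1 by simp
      then have "real (m\<^sup>2) < real (2 * l)"
        by (simp only: of_nat_less_iff)
      then show ?thesis
        unfolding 1 using off that m l by (intro card_balanced_pairs_eq(2)) simp_all
    qed
    ultimately show ?thesis by blast
  next
    case 2
    \<comment> \<open>After rotation k is the odd size out, and k \<ge> l + 1 always provides two
      diagonal solutions; whether there are 4 or 2 in total depends on the off-diagonal
      pair.\<close>
    have "(l - 1)\<^sup>2 + 4 * l = (l + 1)\<^sup>2"
      using l by (cases l) (simp_all add: power2_eq_square)
    moreover have "(l + 1)\<^sup>2 \<le> k\<^sup>2"
      using 2 by (intro power_mono) simp_all
    ultimately have "4 * l \<le> k\<^sup>2"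
      by linarith
    then have "real (4 * l) \<le> real (k\<^sup>2)"
      by (simp only: of_nat_le_iff)
    then have k2: "(real k)\<^sup>2 > 4 * real l - 4"
      by simp
    have card: "?card = card (balanced_pairs (real l) (real l) (real k))"
      using card_balanced_pairs_rotate 2(2) by simp
    have "?card = 4" if "m\<^sup>2 + 4 > 2 * k + 2 * l"
    proof -
      have "l * l + 4 > 4 * l + 2"
        using that 2 by (simp add: power2_eq_square)
      then have "l \<noteq> 2" "l \<noteq> 3"
        by auto
      then have "l \<ge> 4"
        using l by simp
      have "real (l\<^sup>2 + 4) > real (2 * k + 2 * l)"
        using that 2 by (simp only: of_nat_less_iff)
      then have "(2 * real l + real k - 2)\<^sup>2 < (real l)\<^sup>2 * (real l + real k)"
        using \<open>l \<ge> 4\<close> 2 by (intro off_diagonal_condition_large) simp_all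
      then show ?thesis
        unfolding card using k2 l 2 by (intro card_balanced_pairs_eq(1)) simp_all
    qed
    moreover have "?card = 2" if "m\<^sup>2 < k + l"
    proof -
      \<comment> \<open>Now l^2 (l + k) \<le> (l + k)^2 \<le> (2 l + k - 2)^2, so the off-diagonal
        pair disappears.\<close>
      have "real (l\<^sup>2) < real (k + l)"
        using that 2 by (simp only: of_nat_less_iff)
      then have "(real l)\<^sup>2 * (real l + real k) \<le> (real l + real k) * (real l + real k)"
        by (intro mult_right_mono) simp_all
      also have "\<dots> \<le> (2 * real l + real k - 2) * (2 * real l + real k - 2)"
        using l by (intro mult_mono) simp_all
      finally show ?thesis
        unfolding card using k2 l 2 by (intro card_balanced_pairs_eq(3)) (simp_all add: power2_eq_square)
    qed
    ultimately show ?thesis by blast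
  next
    case 3
    interpret distinct_sizes "real k" "real l" "real m"
      using 3 m by unfold_locales simp_all
    have "?card = 4" if "m\<^sup>2 + 4 > 2 * k + 2 * l"
    proof -
      have "real (m\<^sup>2 + 4) > real (2 * k + 2 * l)"
        using that by (simp only: of_nat_less_iff)
      then show ?thesis
        unfolding card_balanced_pairs_admissible by (intro card_admissible_four) (simp add: p_def)
    qed
    moreover have "?card = 2" if "m\<^sup>2 < k + l"
    proof -
      have "(real m)\<^sup>2 \<le> p - 1 \<or> 3 \<le> real m \<and> (real m)\<^sup>2 \<le> p + 1"
      proof (cases "m \<ge> 3")
        case True
        have "m\<^sup>2 + 1 \<le> k + l"
          using that by simp
        then have "real (m\<^sup>2 + 1) \<le> real (k + l)"
          by (simp only: of_nat_le_iff)
        then show ?thesis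
          using True by (simp add: p_def)
      next
        case False
        \<comment> \<open>For m below 3 the stronger alternative is needed; k + l \<ge> 2 m + 3
          supplies it, with equality allowed at m = 2.\<close>
        then have "m = 1 \<or> m = 2"
          using m by linarith
        then have "m\<^sup>2 + 3 \<le> k + l"
          using 3 by auto
        then have "real (m\<^sup>2 + 3) \<le> real (k + l)"
          by (simp only: of_nat_le_iff)
        then show ?thesis
          by (simp add: p_def)
      qed
      then show ?thesis
        unfolding card_balanced_pairs_admissible by (rule card_admissible_two)
    qed
    ultimately show ?thesis by blast
  qed
  then show "m\<^sup>2 + 4 > 2 * k + 2 * l \<Longrightarrow> ?card = 4" "m\<^sup>2 < k + l \<Longrightarrow> ?card = 2"
    by blast+
qed

theorem theorem2:
  fixes k l m :: nat
  assumes "k = CARD('k::finite)" and "l = CARD('l::finite)" and "m = CARD('m::finite)"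
    and "k \<ge> l" and "l \<ge> m" and "m \<ge> 1" and "l \<ge> 2"
  shows "(real m > sqrt (2 * real k + 2 * real l - 4) \<longrightarrow>
            card (einstein_metrics TYPE('k) TYPE('l) TYPE('m) // homothety) = 4)
       \<and> (real m < sqrt (real k + real l) \<longrightarrow>
            card (einstein_metrics TYPE('k) TYPE('l) TYPE('m) // homothety) = 2)"
proof -
  have "CARD('k) + CARD('l) + CARD('m) > 2"
    using assms by linarith
  then have card: "card (einstein_metrics TYPE('k) TYPE('l) TYPE('m) // homothety)
      = card (balanced_pairs (real k) (real l) (real m))"
    unfolding assms(1-3) by (simp only: einstein_metrics_eq card_quotient_homothety)
  have "m\<^sup>2 + 4 > 2 * k + 2 * l" if "real m > sqrt (2 * real k + 2 * real l - 4)"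
  proof -
    have "real (m\<^sup>2 + 4) > real (2 * k + 2 * l)"
    proof -
      have "sqrt (2 * real k + 2 * real l - 4) < sqrt ((real m)\<^sup>2)"
        using that by simp
      then show ?thesis
        unfolding real_sqrt_less_iff by simp
    qed
    then show ?thesis
      by (simp only: of_nat_less_iff)
  qed
  moreover have "m\<^sup>2 < k + l" if "real m < sqrt (real k + real l)"
  proof -
    have "real (m\<^sup>2) < real (k + l)"
    proof -
      have "sqrt ((real m)\<^sup>2) < sqrt (real k + real l)"
        using that by simp
      then show ?thesis
        unfolding real_sqrt_less_iff by simp
    qed
    then show ?thesis
      by (simp only: of_nat_less_iff)
  qed
  ultimately show ?thesis
    unfolding card using card_balanced_pairs[OF assms(4-7)] by blast
qed

end
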